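(* Let $\mu$ be a probability measure on $\Omega$ satisfying (A1), (A2), (A3) and (A4), and let $\omega\sim\mu$. Let $\phi_1$ denote the union of all primal contours of $\phi(\omega)$, and let $G\setminus\phi_1$ be the graph obtained from $G$ by removing every edge of $G$ that is crossed by a present edge of $\mathbb{L}_1$. Then almost surely $G\setminus\phi_1$ has no infinite connected components.
   Context: Let $G$ be the square grid with vertex set $\mathbb{Z}^2$ and nearest-neighbour edges (edges viewed as unit segments in $\mathbb{R}^2$). The face of $G$ with lower-left corner $(m,n)$ is black if $m+n$ is even, white otherwise. $\Omega\subset\{0,1\}^{\mathbb{Z}^2}$ is the set of $\omega$ such that for every black face the states of its four vertices, listed clockwise from the lower-left corner, form one of $0000,1111,0011,1100,0110,1001$. Let $\mathbb{L}_1$ be the graph with vertices $(m-\tfrac12,n+\tfrac12)$, $m,n$ both even, and $\mathbb{L}_2$ the graph with vertices $(m-\tfrac12,n+\tfrac12)$, $m,n$ both odd; in each, two vertices are joined by an edge (a segment of length 2) iff at Euclidean distance $2$. The center of each black face $F$ is the midpoint of exactly one edge $e_1$ of $\mathbb{L}_1$ and one edge $e_2$ of $\mathbb{L}_2$ (perpendicular). For $\omega\in\Omega$ define $\phi(\omega)\in\{0,1\}^{E(\mathbb{L}_1)\cup E(\mathbb{L}_2)}$: if the configuration around $F$ is $0000$ or $1111$ both $e_1,e_2$ get $0$; if the two upper vertices share a state different from the two lower ones, the horizontal one of $e_1,e_2$ gets $1$, the vertical $0$; if the two left vertices share a state different from the two right ones, the vertical one gets $1$, the horizontal $0$. Edges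 with value $1$ are present; contours are connected components of present edges; a primal contour consists of edges of $\mathbb{L}_1$. Assumptions on $\mu$: (A1) invariance under translations by the group generated by $(1,1),(1,-1)$; (A2) every $2\mathbb{Z}\times2\mathbb{Z}$-translation-invariant event has probability $0$ or $1$; (A3) invariance under $\theta(\omega)=1-\omega$; (A4) if $\nu_1$ is the law of the restriction of $\phi(\omega)$ to $E(\mathbb{L}_1)$, then for every face $S$ of $\mathbb{L}_1$ and every event $E$ with $\nu_1(E)>0$ we have $\nu_1(E_S)>0$, where $E_S=\{\psi_S:\psi\in E\}$ and $\psi_S$ is obtained from $\psi$ by flipping the states of the four sides of $S$. *)

theory Defs
  imports "HOL-Probability.Probability"
begin

text \<open>Vertices of G are integer pairs. A configuration assigns to each vertex a
state in {0,1}; we encode state 1 as True and state 0 as False.\<close>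

type_synonym config = "int \<times> int \<Rightarrow> bool"

definition cfg_space :: "config measure" where
  "cfg_space = Pi\<^sub>M UNIV (\<lambda>_. count_space (UNIV :: bool set))"

text \<open>The face with lower-left corner (m,n) is black iff m+n is even.\<close>
definition black :: "int \<Rightarrow> int \<Rightarrow> bool" where
  "black m n \<longleftrightarrow> even (m + n)"

text \<open>Allowed states (LL, UL, UR, LR), i.e. clockwise from the lower-left corner:
0000, 1111, 0011, 1100, 0110, 1001.\<close>
definition allowed :: "(bool \<times> bool \<times> bool \<times> bool) set" where
  "allowed = {(False,False,False,False), (True,True,True,True),
              (False,False,True,True), (True,True,False,False),
              (False,True,True,False), (True,False,False,True)}"

definition Omega :: "config set" where
  "Omega = {\<omega>. \<forall>m n. black m n \<longrightarrow>
      (\<omega> (m,n), \<omega> (m,n+1), \<omega> (m+1,n+1), \<omega> (m+1,n)) \<in> allowed}"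

definition shift :: "int \<times> int \<Rightarrow> config \<Rightarrow> config" where
  "shift t \<omega> = (\<lambda>(a,b). \<omega> (a + fst t, b + snd t))"

definition flip :: "config \<Rightarrow> config" where
  "flip \<omega> = (\<lambda>v. \<not> \<omega> v)"

definition pt :: "int \<times> int \<Rightarrow> real \<times> real" where
  "pt v = (real_of_int (fst v), real_of_int (snd v))"

definition G_edges :: "(int \<times> int) set set" where
  "G_edges = {{(a,b),(c,d)} | a b c d. \<bar>a - c\<bar> + \<bar>b - d\<bar> = 1}"

definition l1v :: "int \<Rightarrow> int \<Rightarrow> real \<times> real" where
  "l1v m n = (real_of_int m - 1/2, real_of_int n + 1/2)"

definition L1_verts :: "(real \<times> real) set" where
  "L1_verts = {l1v m n | m n. even m \<and> even n}"

definition L1_edges :: "(real \<times> real) set set" where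
  "L1_edges = {{p,q} | p q. p \<in> L1_verts \<and> q \<in> L1_verts \<and> dist p q = 2}"

definition L1_face_sides :: "int \<Rightarrow> int \<Rightarrow> (real \<times> real) set set" where
  "L1_face_sides a b =
     {{l1v a b, l1v (a+2) b}, {l1v (a+2) b, l1v (a+2) (b+2)},
      {l1v (a+2) (b+2), l1v a (b+2)}, {l1v a (b+2), l1v a b}}"

definition L1_faces :: "(real \<times> real) set set set" where
  "L1_faces = {L1_face_sides a b | a b. even a \<and> even b}"

definition face_center :: "int \<Rightarrow> int \<Rightarrow> real \<times> real" where
  "face_center m n = (real_of_int m + 1/2, real_of_int n + 1/2)"

definition hwall :: "config \<Rightarrow> int \<Rightarrow> int \<Rightarrow> bool" where
  "hwall \<omega> m n \<longleftrightarrow> \<omega> (m,n+1) = \<omega> (m+1,n+1) \<and> \<omega> (m,n) = \<omega> (m+1,n)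
                     \<and> \<omega> (m,n+1) \<noteq> \<omega> (m,n)"

definition vwall :: "config \<Rightarrow> int \<Rightarrow> int \<Rightarrow> bool" where
  "vwall \<omega> m n \<longleftrightarrow> \<omega> (m,n) = \<omega> (m,n+1) \<and> \<omega> (m+1,n) = \<omega> (m+1,n+1)
                     \<and> \<omega> (m,n) \<noteq> \<omega> (m+1,n)"

definition phi1 :: "config \<Rightarrow> (real \<times> real) set \<Rightarrow> bool" where
  "phi1 \<omega> e \<longleftrightarrow> (\<exists>p q m n. e = {p,q} \<and> black m n \<and> midpoint p q = face_center m n \<and>
       (if snd p = snd q then hwall \<omega> m n else vwall \<omega> m n))"

definition phi1_cfg :: "config \<Rightarrow> (real \<times> real) set \<Rightarrow> bool" where
  "phi1_cfg \<omega> = restrict (phi1 \<omega>) L1_edges"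

definition L1_cfg_space :: "((real \<times> real) set \<Rightarrow> bool) measure" where
  "L1_cfg_space = Pi\<^sub>M L1_edges (\<lambda>_. count_space (UNIV :: bool set))"

definition flip_face :: "(real \<times> real) set set \<Rightarrow> ((real \<times> real) set \<Rightarrow> bool)
     \<Rightarrow> ((real \<times> real) set \<Rightarrow> bool)" where
  "flip_face S \<psi> = (\<lambda>e. if e \<in> S then \<not> \<psi> e else \<psi> e)"

definition crosses :: "(int \<times> int) set \<Rightarrow> (real \<times> real) set \<Rightarrow> bool" where
  "crosses g e \<longleftrightarrow> convex hull (pt ` g) \<inter> convex hull e \<noteq> {}"

text \<open>Adjacency in G minus phi_1: edges of G not crossed by any present edge of L1
(phi_1, the union of all primal contours, is the set of all present L1 edges).\<close>
definition Gminus_adj :: "config \<Rightarrow> int \<times> int \<Rightarrow> int \<times> int \<Rightarrow> bool" where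
  "Gminus_adj \<omega> u v \<longleftrightarrow> {u,v} \<in> G_edges \<and>
      \<not> (\<exists>e \<in> L1_edges. phi1 \<omega> e \<and> crosses {u,v} e)"

definition component :: "config \<Rightarrow> int \<times> int \<Rightarrow> (int \<times> int) set" where
  "component \<omega> v = {w. (Gminus_adj \<omega>)\<^sup>*\<^sup>* v w}"

end

theory Submission
  imports Defs
begin

text \<open>
  Give each face of \<open>L1\<close> a spin such that the present edges of \<open>L1\<close> are exactly the domain walls,
  and likewise for \<open>L2\<close>; both spin fields are determined up to a global sign. The components of
  \<open>G\<close> minus the primal contours are then the spin clusters on the faces of \<open>L1\<close>, the state of a
  vertex is the exclusive or of the two spins of the faces containing it, and the wall of at most
  one of the two fields passes through a black face.

  Ergodicity and invariance under \<open>flip\<close> rule out any almost surely defined invariant choice of a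
  sign that changes when only one of the two fields is negated. Hence each sign has the same number
  of infinite clusters (up to two). Finite energy excludes three infinite clusters of the same sign
  (Burton and Keane) and then, by merging, two. Suppose there is exactly one of each sign. The
  boundary between an infinite cluster and the complementary component containing the other one is
  connected, and the second field is constant along it because walls do not cross. Comparing these
  constants for the two signs and for the two fields again yields such an invariant choice.
\<close>
section \<open>Connectivity in the square lattice\<close>

text \<open>A field gets a sign by prescribing its value at one face, but translations do not
  respect that choice. What survives is the relative sign: \<open>\<omega>\<close> singles out a
  pair of spin fields up to joint negation, and \<open>flip\<close> negates just one member of the
  pair. This is why symmetry alone controls relations between the fields and says nothing about
  either field taken singly. The obstacle is coexistence of one infinite cluster of each sign:
  finite modifications cannot destroy it, and no correlation inequality is at hand. The value that
  the second field shows along the interface might depend on the sign of the cluster; such a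
  dependence ties the signs of the two fields together and is excluded. If there is none, the common
  value follows the sign of the second field alone. Exchanging the lattices by the translation (1,1)
  yields a value that follows the sign of the first field alone, and comparing the two values ties
  the signs together once more. (A4) speaks of \<open>L1\<close> only; the second field inherits
  almost sure statements through the same translation.\<close>

type_synonym site = "int \<times> int"

definition nb :: "site \<Rightarrow> site \<Rightarrow> bool" where
  "nb u v \<longleftrightarrow> \<bar>fst u - fst v\<bar> + \<bar>snd u - snd v\<bar> = 1"

text \<open>Reflexivity holds outside \<open>X\<close> as well, so a point outside \<open>X\<close>
  is connected to itself and to nothing else. Membership in \<open>X\<close> is demanded separately
  wherever it matters.\<close>

definition conn :: "site set \<Rightarrow> site \<Rightarrow> site \<Rightarrow> bool" where
  "conn X = (\<lambda>x y. nb x y \<and> x \<in> X \<and> y \<in> X)\<^sup>*\<^sup>*"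

lemma nb_sym: "nb u v \<Longrightarrow> nb v u"
  unfolding nb_def by arith

lemma nb_cases:
  assumes "nb x y"
  obtains i j where "x = (i, j)" "y = (i + 1, j)" | i j where "x = (i + 1, j)" "y = (i, j)"
    | i j where "x = (i, j)" "y = (i, j + 1)" | i j where "x = (i, j + 1)" "y = (i, j)"
proof -
  obtain a b c d where xy: "x = (a, b)" "y = (c, d)" by (cases x; cases y)
  have "\<bar>a - c\<bar> + \<bar>b - d\<bar> = 1" using assms by (simp add: nb_def xy)
  then have "c = a + 1 \<and> d = b \<or> a = c + 1 \<and> b = d \<or> c = a \<and> d = b + 1 \<or> a = c \<and> b = d + 1"
    by arith
  then show thesis
  proof (elim disjE conjE)
    assume "c = a + 1" "d = b" then show thesis using that(1)[of a b] xy by simp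
  next
    assume "a = c + 1" "b = d" then show thesis using that(2)[of c d] xy by simp
  next
    assume "c = a" "d = b + 1" then show thesis using that(3)[of a b] xy by simp
  next
    assume "a = c" "b = d + 1" then show thesis using that(4)[of c d] xy by simp
  qed
qed

lemma conn_refl [simp]: "conn X u u"
  by (simp add: conn_def)

lemma conn_edge: "nb u v \<Longrightarrow> u \<in> X \<Longrightarrow> v \<in> X \<Longrightarrow> conn X u v"
  unfolding conn_def by (rule r_into_rtranclp) simp

lemma conn_trans [trans]: "conn X u v \<Longrightarrow> conn X v w \<Longrightarrow> conn X u w"
  unfolding conn_def by (rule rtranclp_trans)

lemma conn_sym: "conn X u v \<Longrightarrow> conn X v u"
  unfolding conn_def
proof (induction rule: rtranclp_induct)
  case (step y z)
  then show ?case by (intro converse_rtranclp_into_rtranclp[of _ z y]) (auto intro: nb_sym)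
qed simp

lemma conn_induct [consumes 1, case_names refl step]:
  assumes "conn X u v" "P u"
    "\<And>y z. conn X u y \<Longrightarrow> P y \<Longrightarrow> nb y z \<Longrightarrow> y \<in> X \<Longrightarrow> z \<in> X \<Longrightarrow> P z"
  shows "P v"
  using assms(1)[unfolded conn_def]
proof (induction rule: rtranclp_induct)
  case base
  show ?case by (rule assms(2))
next
  case (step y z)
  then show ?case using assms(3)[of y z] unfolding conn_def by simp
qed

lemma conn_converse_induct [consumes 1, case_names refl step]:
  assumes "conn X u v" "P v"
    "\<And>y z. nb y z \<Longrightarrow> y \<in> X \<Longrightarrow> z \<in> X \<Longrightarrow> conn X z v \<Longrightarrow> P z \<Longrightarrow> P y"
  shows "P u"
  using assms(1)[unfolded conn_def]
proof (induction rule: converse_rtranclp_induct)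
  case base
  show ?case by (rule assms(2))
next
  case (step y z)
  then show ?case using assms(3)[of y z] unfolding conn_def by simp
qed

lemma conn_mono: "conn X u v \<Longrightarrow> X \<subseteq> Y \<Longrightarrow> conn Y u v"
proof (induction rule: conn_induct)
  case (step y z)
  have "conn Y y z" using step by (intro conn_edge) auto
  then show ?case using step conn_trans by blast
qed simp

lemma conn_in: "conn X u v \<Longrightarrow> u \<in> X \<Longrightarrow> v \<in> X"
  by (induction rule: conn_induct) auto

lemma conn_const:
  assumes "conn X u v" "\<And>x y. nb x y \<Longrightarrow> x \<in> X \<Longrightarrow> y \<in> X \<Longrightarrow> f x = f y"
  shows "f u = f v"
  using assms(1) by (induction rule: conn_induct) (use assms(2) in auto)

lemma conn_in_cluster: "conn X u v \<Longrightarrow> conn {y \<in> X. conn X u y} u v"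
proof (induction rule: conn_induct)
  case (step y z)
  then have "conn X u z" by (meson conn_edge conn_trans)
  then have "conn {y \<in> X. conn X u y} y z"
    using step by (intro conn_edge) auto
  then show ?case using step.IH conn_trans by blast
qed simp

lemma conn_restrict:
  assumes "conn X u v" "\<And>y. y \<in> X \<Longrightarrow> conn X u y \<Longrightarrow> y \<in> Y"
  shows "conn Y u v"
  using conn_in_cluster[OF assms(1)] by (rule conn_mono) (use assms(2) in auto)

lemma conn_translate1: "conn X u v \<Longrightarrow> conn ((\<lambda>x. x + t) -` X) (u - t) (v - t)"
proof (induction rule: conn_induct)
  case (step y z)
  have "conn ((\<lambda>x. x + t) -` X) (y - t) (z - t)"
    using step by (intro conn_edge) (auto simp: nb_def)
  with step.IH show ?case by (rule conn_trans)
qed simp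

lemma conn_translate: "conn ((\<lambda>x. x + t) -` X) u v \<longleftrightarrow> conn X (u + t) (v + t)"
proof
  assume "conn ((\<lambda>x. x + t) -` X) u v"
  from conn_translate1[OF this, of "-t"] show "conn X (u + t) (v + t)"
    by (simp add: vimage_def)
next
  assume "conn X (u + t) (v + t)"
  from conn_translate1[OF this, of t] show "conn ((\<lambda>x. x + t) -` X) u v"
    by simp
qed

text \<open>Cutting a path after its last visit to \<open>B\<close> leaves a tail in
  \<open>X - B\<close>. This converts connections through a box into connections inside a branch of
  its complement.\<close>

lemma conn_last_exit:
  assumes "conn X z p" "p \<notin> B"
  shows "(z \<notin> B \<and> conn (X - B) z p) \<or>
    (\<exists>z0 z1. z0 \<in> B \<and> nb z0 z1 \<and> z0 \<in> X \<and> z1 \<in> X - B \<and> conn (X - B) z1 p)"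
  using assms(1)
proof (induction rule: conn_converse_induct)
  case (step y z)
  show ?case
  proof (cases "z \<notin> B \<and> conn (X - B) z p")
    case True
    show ?thesis
    proof (cases "y \<in> B")
      case False
      then have "conn (X - B) y z" using step True by (intro conn_edge) auto
      then show ?thesis using True False conn_trans by blast
    qed (use True step in blast)
  qed (use step in blast)
qed (use assms in auto)

definition sqbox :: "site \<Rightarrow> int \<Rightarrow> site set" where
  "sqbox x n = {v. \<bar>fst v - fst x\<bar> \<le> n \<and> \<bar>snd v - snd x\<bar> \<le> n}"

lemma sqbox_eq: "sqbox x n = {fst x - n..fst x + n} \<times> {snd x - n..snd x + n}"
  by (auto simp: sqbox_def)

lemma finite_box [simp]: "finite (sqbox x n)"
  by (simp add: sqbox_eq)

lemma conn_box_centre: "u \<in> sqbox x n \<Longrightarrow> conn (sqbox x n) u x"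
proof (induction "nat (\<bar>fst u - fst x\<bar> + \<bar>snd u - snd x\<bar>)" arbitrary: u rule: less_induct)
  case less
  obtain p q where u: "u = (p, q)" by (cases u)
  obtain a b where x: "x = (a, b)" by (cases x)
  show ?case
  proof (cases "u = x")
    case False
    define w where "w = (if p < a then (p + 1, q) else if p > a then (p - 1, q)
                          else if q < b then (p, q + 1) else (p, q - 1))"
    have w: "nb u w" "w \<in> sqbox x n"
        "\<bar>fst w - fst x\<bar> + \<bar>snd w - snd x\<bar> < \<bar>fst u - fst x\<bar> + \<bar>snd u - snd x\<bar>"
      using False less.prems unfolding w_def u x by (auto simp: nb_def sqbox_def split: if_splits)
    then have "conn (sqbox x n) w x" by (intro less.hyps) auto
    moreover have "conn (sqbox x n) u w" using w less.prems by (intro conn_edge)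
    ultimately show ?thesis using conn_trans by blast
  qed simp
qed

lemma conn_box: "u \<in> sqbox x n \<Longrightarrow> v \<in> sqbox x n \<Longrightarrow> conn (sqbox x n) u v"
  using conn_box_centre conn_sym conn_trans by blast

lemma conn_UNIV [simp]: "conn UNIV u v"
proof -
  have "u \<in> sqbox v (max \<bar>fst u - fst v\<bar> \<bar>snd u - snd v\<bar>)" by (auto simp: sqbox_def)
  from conn_box_centre[OF this] show ?thesis by (rule conn_mono) simp
qed

lemma finite_subset_box:
  fixes F :: "site set"
  assumes "finite F" shows "\<exists>n. F \<subseteq> sqbox 0 n"
  using assms
proof (induction F)
  case (insert v F)
  then obtain n where n: "F \<subseteq> sqbox 0 n" by blast
  show ?case
    by (rule exI[of _ "max n (max \<bar>fst v\<bar> \<bar>snd v\<bar>)"]) (use n in \<open>auto simp: sqbox_def\<close>)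
qed auto

section \<open>Potentials of mod 2 one-forms\<close>

text \<open>The integral of \<open>d\<close> modulo 2 from 0 to \<open>i\<close>; \<open>min\<close>
  and \<open>max\<close> cover negative \<open>i\<close>, since orientation is irrelevant modulo
  2.\<close>

definition pot1 :: "(int \<Rightarrow> bool) \<Rightarrow> int \<Rightarrow> bool" where
  "pot1 d i = odd (card {k \<in> {min 0 i..<max 0 i}. d k})"

lemma pot1_0 [simp]: "pot1 d 0 = False"
  by (simp add: pot1_def)

lemma pot1_step: "pot1 d (i + 1) = (pot1 d i \<noteq> d i)"
proof -
  define S where "S i = {k \<in> {min 0 i..<max 0 i}. d k}" for i
  have fin: "finite (S k)" for k
    unfolding S_def by (rule finite_subset[of _ "{min 0 k..<max 0 k}"]) auto
  show ?thesis
  proof (cases "i \<ge> 0")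
    case True
    then have "{min 0 (i + 1)..<max 0 (i + 1)} = insert i {min 0 i..<max 0 i}"
      by auto
    then have "S (i + 1) = (if d i then insert i (S i) else S i)" "i \<notin> S i"
      using True by (auto simp: S_def)
    then show ?thesis
      using fin unfolding pot1_def S_def[symmetric] by simp
  next
    case False
    then have "{min 0 i..<max 0 i} = insert i {min 0 (i + 1)..<max 0 (i + 1)}"
      by auto
    then have "S i = (if d i then insert i (S (i + 1)) else S (i + 1))" "i \<notin> S (i + 1)"
      using False by (auto simp: S_def)
    then show ?thesis
      using fin unfolding pot1_def S_def[symmetric] by simp
  qed
qed

text \<open>Integration along the horizontal axis and then vertically. The value at the origin is
  always \<open>False\<close>; this is the normalisation that translations break.\<close>

definition potential :: "config \<Rightarrow> config \<Rightarrow> config" where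
  "potential h v = (\<lambda>(i, j). pot1 (\<lambda>k. h (k, 0)) i \<noteq> pot1 (\<lambda>k. v (i, k)) j)"

definition is_pot :: "config \<Rightarrow> config \<Rightarrow> config \<Rightarrow> bool" where
  "is_pot h v s \<longleftrightarrow> (\<forall>i j. (s (i, j) \<noteq> s (i + 1, j)) = h (i, j) \<and> (s (i, j) \<noteq> s (i, j + 1)) = v (i, j))"

definition closed_form :: "config \<Rightarrow> config \<Rightarrow> bool" where
  "closed_form h v \<longleftrightarrow> (\<forall>i j. (h (i, j) = h (i, j + 1)) = (v (i, j) = v (i + 1, j)))"

text \<open>Vertical differences hold by construction, horizontal ones on the axis; closedness
  carries the latter from row to row.\<close>

lemma is_pot_potential:
  assumes "closed_form h v" shows "is_pot h v (potential h v)"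
proof -
  let ?g = "potential h v"
  have vert: "(?g (i, j) \<noteq> ?g (i, j + 1)) = v (i, j)" for i j
    by (auto simp: potential_def pot1_step)
  have "(?g (i, j) \<noteq> ?g (i + 1, j)) = h (i, j)" for i j
  proof (induction j rule: int_induct[where k = 0])
    case base
    show ?case by (auto simp: potential_def pot1_step)
  next
    case (step1 j)
    then show ?case using vert[of i j] vert[of "i + 1" j] assms[unfolded closed_form_def, rule_format, of i j]
      by auto
  next
    case (step2 j)
    then show ?case using vert[of i "j - 1"] vert[of "i + 1" "j - 1"]
        assms[unfolded closed_form_def, rule_format, of i "j - 1"]
      by auto
  qed
  with vert show ?thesis by (auto simp: is_pot_def)
qed

lemma is_pot_closed: "is_pot h v s \<Longrightarrow> closed_form h v"
  unfolding closed_form_def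
proof (intro allI)
  fix i j
  assume "is_pot h v s"
  then have *: "(s (i, j) \<noteq> s (i + 1, j)) = h (i, j)" "(s (i, j) \<noteq> s (i, j + 1)) = v (i, j)" for i j
    unfolding is_pot_def by blast+
  show "(h (i, j) = h (i, j + 1)) = (v (i, j) = v (i + 1, j))"
    using *(1)[of i j] *(1)[of i "j + 1"] *(2)[of i j] *(2)[of "i + 1" j] by argo
qed

lemma unit_invariant_const:
  fixes f :: "site \<Rightarrow> 'a"
  assumes "\<And>i j. f (i + 1, j) = f (i, j)" "\<And>i j. f (i, j + 1) = f (i, j)"
  shows "f u = f v"
proof (rule conn_const[of UNIV])
  fix x y :: site assume "nb x y"
  then show "f x = f y" by (cases rule: nb_cases) (simp_all add: assms)
qed simp

lemma is_pot_unique: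
  assumes "is_pot h v s" "is_pot h v s'"
  shows "s' = s \<or> s' = flip s"
proof -
  have "(s x = s' x) = (s 0 = s' 0)" for x
    by (rule unit_invariant_const) (use assms in \<open>auto simp: is_pot_def\<close>)
  then show ?thesis by (cases "s 0 = s' 0") (auto simp: flip_def fun_eq_iff)
qed

lemma flip_flip [simp]: "flip (flip s) = s"
  by (simp add: flip_def)

lemma shift_apply: "shift t s v = s (v + t)"
  by (cases v; cases t) (simp add: shift_def)

lemma shift_flip: "shift t (flip s) = flip (shift t s)"
  by (simp add: fun_eq_iff shift_apply flip_def)

lemma shift_shift: "shift t (shift u s) = shift (t + u) s"
  by (simp add: fun_eq_iff shift_apply add.assoc)

text \<open>A site stands here for the plaquette of which it is the lower-left corner. The selected
  plaquettes are those through which the boundary of \<open>K\<close> passes.\<close>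

definition straddles :: "site set \<Rightarrow> site set" where
  "straddles K = {(i, j). \<not> {(i,j), (i+1,j), (i,j+1), (i+1,j+1)} \<subseteq> K \<and>
                          {(i,j), (i+1,j), (i,j+1), (i+1,j+1)} \<inter> K \<noteq> {}}"

text \<open>The boundary edges of \<open>K\<close> at which \<open>s\<close> takes a given value form a closed one-form mod 2.
  Its potential is constant on \<open>K\<close> and on the complement, so the one-form contains all boundary
  edges or none.\<close>

lemma boundary_const:
  fixes s :: config
  assumes K: "\<And>u v. u \<in> K \<Longrightarrow> v \<in> K \<Longrightarrow> conn K u v"
    and K': "\<And>u v. u \<notin> K \<Longrightarrow> v \<notin> K \<Longrightarrow> conn (- K) u v"
    and h: "\<And>i j. ((i, j) \<in> K) \<noteq> ((i + 1, j) \<in> K) \<Longrightarrow> s (i, j - 1) = s (i, j)"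
    and v: "\<And>i j. ((i, j) \<in> K) \<noteq> ((i, j + 1) \<in> K) \<Longrightarrow> s (i - 1, j) = s (i, j)"
    and w: "w \<in> straddles K" "w' \<in> straddles K"
  shows "s w' = s w"
proof -
  define H where "H = (\<lambda>(i, j). ((i, j) \<in> K) \<noteq> ((i + 1, j) \<in> K) \<and> s (i, j) = s w)"
  define V where "V = (\<lambda>(i, j). ((i, j) \<in> K) \<noteq> ((i, j + 1) \<in> K) \<and> s (i, j) = s w)"
  \<comment> \<open>By the hypotheses all boundary edges around the plaquette \<open>(i, j)\<close>
    carry the value \<open>s (i, j)\<close>, so all or none of them belong to the form. Their number
    is even because a walk around the plaquette ends where it began.\<close>
  have "closed_form H V"
    unfolding closed_form_def
  proof (intro allI)
    fix i j
    show "(H (i, j) = H (i, j + 1)) = (V (i, j) = V (i + 1, j))"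
      using h[of i "j + 1"] v[of "i + 1" j] unfolding H_def V_def by auto
  qed
  then obtain g where g: "is_pot H V g" using is_pot_potential by blast
  have gK: "g x = g y" if "(x \<in> K) = (y \<in> K)" for x y
  proof -
    have *: "g x = g y" if "nb x y" "(x \<in> K) = (y \<in> K)" for x y
    proof -
      have "(g (i, j) = g (i + 1, j)) = (\<not> H (i, j))" "(g (i, j) = g (i, j + 1)) = (\<not> V (i, j))" for i j
        using g unfolding is_pot_def by blast+
      then show ?thesis
        using that(2) by (cases rule: nb_cases[OF that(1)]) (simp_all add: H_def V_def eq_commute)
    qed
    show ?thesis
    proof (cases "x \<in> K")
      case True
      then have "conn K x y" using K that by blast
      then show ?thesis by (rule conn_const) (rule *, auto)
    next
      case False
      then have "conn (-K) x y" using K' that by blast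
      then show ?thesis by (rule conn_const) (rule *, auto)
    qed
  qed
  \<comment> \<open>Some side of the plaquette \<open>w\<close> is a boundary edge, and it belongs
    to the form because it carries \<open>s w\<close>. One such edge suffices to separate the two
    constant values of \<open>g\<close>.\<close>
  have sep: "g x \<noteq> g y" if "x \<in> K" "y \<notin> K" for x y
  proof -
    obtain i j where ij: "w = (i, j)" by (cases w)
    have "\<exists>x y. x \<in> K \<and> y \<notin> K \<and> g x \<noteq> g y"
    proof -
      have "((i,j) \<in> K) \<noteq> ((i+1,j) \<in> K) \<or> ((i,j) \<in> K) \<noteq> ((i,j+1) \<in> K)
          \<or> ((i,j+1) \<in> K) \<noteq> ((i+1,j+1) \<in> K) \<or> ((i+1,j) \<in> K) \<noteq> ((i+1,j+1) \<in> K)"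
        using w(1) unfolding ij straddles_def by auto
      then have "H (i, j) \<or> V (i, j) \<or> H (i, j + 1) \<or> V (i + 1, j)"
        using h[of i "j + 1"] v[of "i + 1" j] unfolding H_def V_def ij by auto
      then have "g (i,j) \<noteq> g (i+1,j) \<or> g (i,j) \<noteq> g (i,j+1) \<or> g (i,j+1) \<noteq> g (i+1,j+1)
          \<or> g (i+1,j) \<noteq> g (i+1,j+1)"
        using g unfolding is_pot_def by blast
      then show ?thesis using gK by metis
    qed
    then obtain x' y' where "x' \<in> K" "y' \<notin> K" "g x' \<noteq> g y'" by blast
    then show ?thesis using gK that by metis
  qed
  obtain i j where ij: "w' = (i, j)" by (cases w')
  \<comment> \<open>Since \<open>g\<close> differs across every boundary edge, those around
    \<open>w'\<close> all belong to the form and therefore carry \<open>s w\<close>.\<close>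
  have "((i,j) \<in> K) \<noteq> ((i+1,j) \<in> K) \<or> ((i,j) \<in> K) \<noteq> ((i,j+1) \<in> K)
      \<or> ((i,j+1) \<in> K) \<noteq> ((i+1,j+1) \<in> K) \<or> ((i+1,j) \<in> K) \<noteq> ((i+1,j+1) \<in> K)"
    using w(2) unfolding ij straddles_def by auto
  moreover have "((i,j) \<in> K) \<noteq> ((i+1,j) \<in> K) \<Longrightarrow> H (i, j)"
    using g sep unfolding is_pot_def by metis
  moreover have "((i,j) \<in> K) \<noteq> ((i,j+1) \<in> K) \<Longrightarrow> V (i, j)"
    using g sep unfolding is_pot_def by metis
  moreover have "((i,j+1) \<in> K) \<noteq> ((i+1,j+1) \<in> K) \<Longrightarrow> H (i, j+1)"
    using g sep unfolding is_pot_def by metis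
  moreover have "((i+1,j) \<in> K) \<noteq> ((i+1,j+1) \<in> K) \<Longrightarrow> V (i+1, j)"
    using g sep unfolding is_pot_def by metis
  ultimately show ?thesis using h[of i "j + 1"] v[of "i + 1" j] unfolding H_def V_def ij by auto
qed

lemma straddles_nonempty:
  assumes "x \<in> K" "y \<notin> K" shows "straddles K \<noteq> {}"
proof
  assume e: "straddles K = {}"
  have "(i, j) \<in> K \<longleftrightarrow> (i + 1, j) \<in> K" "(i, j) \<in> K \<longleftrightarrow> (i, j + 1) \<in> K" for i j
    using e unfolding straddles_def by auto
  then have "(x \<in> K) = (y \<in> K)" by (rule unit_invariant_const[where f = "\<lambda>x. x \<in> K", OF sym sym])
  with assms show False by simp
qed

section \<open>Infinite clusters and trifurcations\<close>

text \<open>Induction removing an outermost box \<open>B t\<close>, one with two branches free of other boxes, together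
  with one point of \<open>S\<close> in such a branch; a point in the second branch replaces it.\<close>

lemma trifurcation_count:
  fixes B :: "'t \<Rightarrow> site set"
  assumes "finite T" "finite S"
    and "\<And>t t'. t \<in> T \<Longrightarrow> t' \<in> T \<Longrightarrow> t \<noteq> t' \<Longrightarrow> B t \<inter> B t' = {}"
    and "\<And>t. t \<in> T \<Longrightarrow> B t \<subseteq> X"
    and "\<And>t u v. t \<in> T \<Longrightarrow> u \<in> B t \<Longrightarrow> v \<in> B t \<Longrightarrow> conn (B t) u v"
    and "\<And>t. t \<in> T \<Longrightarrow> B t \<inter> S = {}"
    and "\<And>t. t \<in> T \<Longrightarrow> \<exists>s1\<in>S. \<exists>s2\<in>S. \<exists>s3\<in>S. (\<forall>s\<in>{s1, s2, s3}. \<exists>z\<in>B t. conn X z s) \<and>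
        \<not> conn (X - B t) s1 s2 \<and> \<not> conn (X - B t) s1 s3 \<and> \<not> conn (X - B t) s2 s3"
  shows "card T \<le> card S"
  using assms
proof (induction "card T" arbitrary: T S)
  case 0
  then show ?case by simp
next
  case (Suc n)
  note disj = Suc.prems(3) and BX = Suc.prems(4) and Bc = Suc.prems(5) and BS = Suc.prems(6)
    and tri = Suc.prems(7)
  \<comment> \<open>\<open>br t s\<close> is the branch at \<open>s\<close> once the box is deleted,
    and \<open>Y t s\<close> collects the other boxes of the same cluster that miss this branch. The
    outermost box sought is one with \<open>Y t s\<close> empty: all other boxes of its cluster
    touch a single branch.\<close>
  define cl where "cl t s \<longleftrightarrow> (\<exists>z\<in>B t. conn X z s)" for t s
  define br where "br t s = {y. conn (X - B t) s y}" for t s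
  define Y where "Y t s = {t' \<in> T - {t}. B t' \<inter> br t s = {} \<and> (\<exists>z\<in>B t. \<exists>z'\<in>B t'. conn X z z')}" for t s
  have piece: "conn (X - B') z p"
    if t: "t \<in> T" and p: "p \<in> S" "cl t p" and B': "B' \<inter> B t = {}" "B' \<inter> br t p = {}" and z: "z \<in> B t"
    for t B' p z
  proof -
    obtain z2 where z2: "z2 \<in> B t" "conn X z2 p" using p(2) unfolding cl_def by blast
    have "p \<notin> B t" using BS[OF t] p(1) by blast
    from conn_last_exit[OF z2(2) this] z2(1) obtain z0 z1 where
      z0: "z0 \<in> B t" "nb z0 z1" "z0 \<in> X" "z1 \<in> X - B t" "conn (X - B t) z1 p" by blast
    have c: "conn (X - B t) p z1" using z0(5) by (rule conn_sym)
    then have "conn (X - B') p z1"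
      by (rule conn_restrict) (use B' in \<open>auto simp: br_def\<close>)
    then have 1: "conn (X - B') z1 p" by (rule conn_sym)
    have "z1 \<in> br t p" using c by (simp add: br_def)
    then have 2: "conn (X - B') z0 z1" using z0 B' by (intro conn_edge) auto
    have "conn (B t) z z0" using Bc[OF t z z0(1)] .
    then have 3: "conn (X - B') z z0" by (rule conn_mono) (use BX[OF t] B' in auto)
    show ?thesis by (rule conn_trans[OF 3 conn_trans[OF 2 1]])
  qed
  have nonempty: "B t \<noteq> {}" if "t \<in> T" for t using tri[OF that] by blast
  have tfin: "finite (Y t s)" for t s using Suc.prems(1) by (auto simp: Y_def)
  obtain t0 where t0: "t0 \<in> T" using Suc.hyps(2) by (metis card.empty ex_in_conv nat.distinct(1))
  then obtain s0 where s0: "s0 \<in> S" "cl t0 s0" using tri[OF t0] unfolding cl_def by blast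
  \<comment> \<open>Descent on the size of \<open>Y\<close>: a box \<open>t'\<close> counted for
    \<open>t\<close> has \<open>t\<close> on its own branch towards \<open>s0\<close>, and that
    branch contains the old one. Passing from \<open>t\<close> to \<open>t'\<close> thus removes
    \<open>t'\<close> from the count and adds nothing.\<close>
  have "\<exists>t s. t \<in> T \<and> s \<in> S \<and> cl t s \<and> Y t s = {}"
    using t0 s0
  proof (induction "card (Y t0 s0)" arbitrary: t0 rule: less_induct)
    case (less t)
    show ?case
    proof (cases "Y t s0 = {}")
      case True
      then show ?thesis using less.prems by blast
    next
      case False
      then obtain t' z z' where t': "t' \<in> T" "t' \<noteq> t" "B t' \<inter> br t s0 = {}"
        and z: "z \<in> B t" "z' \<in> B t'" "conn X z z'" unfolding Y_def by blast
      have d: "B t' \<inter> B t = {}" using disj[OF t'(1) less.prems(1) t'(2)] .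
      have pz: "conn (X - B t') z s0" using piece[OF less.prems(1,2,3) d t'(3) z(1)] .
      have "conn X z s0" using pz by (rule conn_mono) auto
      then have "conn X z' s0" using z(3) conn_sym conn_trans by blast
      then have cl': "cl t' s0" using z(2) unfolding cl_def by blast
      have tY: "t \<notin> Y t' s0"
        using pz z(1) conn_sym unfolding Y_def br_def by blast
      have brsub: "br t s0 \<subseteq> br t' s0"
      proof
        fix y assume "y \<in> br t s0"
        then have "conn (X - B t) s0 y" by (simp add: br_def)
        then have "conn (X - B t') s0 y"
          by (rule conn_restrict) (use t'(3) in \<open>auto simp: br_def\<close>)
        then show "y \<in> br t' s0" by (simp add: br_def)
      qed
      have "Y t' s0 \<subseteq> Y t s0"
      proof
        fix r assume r: "r \<in> Y t' s0"
        then obtain y y' where y: "y \<in> B t'" "y' \<in> B r" "conn X y y'" unfolding Y_def by blast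
        have "conn (B t') z' y" by (rule Bc[OF t'(1) z(2) y(1)])
        then have "conn X z' y" by (rule conn_mono) (rule BX[OF t'(1)])
        then have "conn X z y'" using z(3) y(3) conn_trans by blast
        then show "r \<in> Y t s0"
          using r tY brsub z(1) y(2) unfolding Y_def by blast
      qed
      moreover have "t' \<in> Y t s0" "t' \<notin> Y t' s0" using t' z unfolding Y_def by auto
      ultimately have "card (Y t' s0) < card (Y t s0)" by (intro psubset_card_mono tfin) auto
      then show ?thesis using less.hyps less.prems(2) t'(1) cl' by blast
    qed
  qed
  then obtain t s where ts: "t \<in> T" "s \<in> S" "cl t s" "Y t s = {}" by blast
  obtain s1 s2 s3 where s123: "s1 \<in> S" "s2 \<in> S" "s3 \<in> S" "cl t s1" "cl t s2" "cl t s3"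
    "\<not> conn (X - B t) s1 s2" "\<not> conn (X - B t) s1 s3" "\<not> conn (X - B t) s2 s3"
    using tri[OF ts(1)] unfolding cl_def by blast
  have tr: "conn (X - B t) a b" if "conn (X - B t) s a" "conn (X - B t) s b" for a b
    using that conn_sym conn_trans by blast
  have "\<exists>p\<in>S. \<exists>q\<in>S. cl t p \<and> cl t q \<and> \<not> conn (X - B t) p q \<and> \<not> conn (X - B t) s p \<and> \<not> conn (X - B t) s q"
  proof (cases "conn (X - B t) s s1")
    case True
    then have "\<not> conn (X - B t) s s2" "\<not> conn (X - B t) s s3" using tr s123 by blast+
    then show ?thesis using s123 by blast
  next
    case n1: False
    show ?thesis
    proof (cases "conn (X - B t) s s2")
      case True
      then have "\<not> conn (X - B t) s s3" using tr s123 by blast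
      then show ?thesis using s123 n1 by blast
    qed (use s123 n1 in blast)
  qed
  then obtain p q where pq: "p \<in> S" "q \<in> S" "cl t p" "cl t q" "\<not> conn (X - B t) p q"
    "\<not> conn (X - B t) s p" "\<not> conn (X - B t) s q" by blast
  \<comment> \<open>By the choice of \<open>t\<close>, a box meeting another branch also meets the
    branch of \<open>s\<close>. Being connected and disjoint from \<open>B t\<close>, it would join
    the two branches.\<close>
  have avoid: "B t' \<inter> br t r = {}" if t': "t' \<in> T" "t' \<noteq> t" and r: "r \<in> S" "cl t r" "\<not> conn (X - B t) s r" for t' r
  proof (rule ccontr)
    assume "B t' \<inter> br t r \<noteq> {}"
    then obtain y where y: "y \<in> B t'" "conn (X - B t) r y" by (auto simp: br_def)
    obtain z where z: "z \<in> B t" "conn X z r" using r(2) unfolding cl_def by blast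
    have "conn X r y" using y(2) by (rule conn_mono) auto
    then have "conn X z y" using z(2) conn_trans by blast
    then have "B t' \<inter> br t s \<noteq> {}" using ts(4) z(1) y(1) t' unfolding Y_def by blast
    then obtain y' where y': "y' \<in> B t'" "conn (X - B t) s y'" by (auto simp: br_def)
    have "conn (B t') y' y" by (rule Bc[OF t'(1) y'(1) y(1)])
    then have "conn (X - B t) y' y"
      by (rule conn_mono) (use disj[OF ts(1) t'(1)] t'(2) BX[OF t'(1)] in auto)
    then show False using y(2) y'(2) r(3) conn_trans conn_sym by blast
  qed
  have pq_conn: "conn (X - B t') p q" if t': "t' \<in> T" "t' \<noteq> t" for t'
  proof -
    obtain z where z: "z \<in> B t" using nonempty[OF ts(1)] by blast
    have d: "B t' \<inter> B t = {}" using disj[OF t'(1) ts(1) t'(2)] .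
    have "conn (X - B t') z p" "conn (X - B t') z q"
      using piece[OF ts(1) pq(1,3) d avoid[OF t' pq(1,3,6)] z]
        piece[OF ts(1) pq(2,4) d avoid[OF t' pq(2,4,7)] z] by auto
    then show ?thesis using conn_sym conn_trans by blast
  qed
  have pnq: "p \<noteq> q" using pq(5) by auto
  have "card (T - {t}) \<le> card (S - {p})"
  proof (rule Suc.hyps(1))
    show "n = card (T - {t})" using Suc.hyps(2) ts(1) by simp
  next
    fix t' assume t': "t' \<in> T - {t}"
    \<comment> \<open>Off any remaining box, \<open>p\<close> and \<open>q\<close> are connected
      through \<open>B t\<close>, so \<open>q\<close> can replace \<open>p\<close> as a witness for
      that box.\<close>
    define f where "f r = (if r = p then q else r)" for r
    have f: "f r \<in> S - {p}" "conn (X - B t') r (f r)" if "r \<in> S" for r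
      using that pnq pq pq_conn[of t'] t' by (auto simp: f_def)
    have fcl: "\<exists>z\<in>B t'. conn X z (f r)" if "r \<in> S" "\<exists>z\<in>B t'. conn X z r" for r
    proof -
      have "conn X r (f r)" using f(2)[OF that(1)] by (rule conn_mono) auto
      then show ?thesis using that(2) conn_trans by blast
    qed
    have fn: "\<not> conn (X - B t') (f r) (f r')" if "r \<in> S" "r' \<in> S" "\<not> conn (X - B t') r r'" for r r'
      using f(2)[OF that(1)] f(2)[OF that(2)] that(3) conn_trans conn_sym by blast
    have "t' \<in> T" using t' by simp
    from tri[OF this] obtain r1 r2 r3 where r: "r1 \<in> S" "r2 \<in> S" "r3 \<in> S"
      "\<forall>s\<in>{r1, r2, r3}. \<exists>z\<in>B t'. conn X z s"
      "\<not> conn (X - B t') r1 r2" "\<not> conn (X - B t') r1 r3" "\<not> conn (X - B t') r2 r3" by blast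
    have A: "\<forall>s\<in>{f r1, f r2, f r3}. \<exists>z\<in>B t'. conn X z s"
      using r(1-4) fcl[of r1] fcl[of r2] fcl[of r3] by simp
    show "\<exists>s1\<in>S - {p}. \<exists>s2\<in>S - {p}. \<exists>s3\<in>S - {p}. (\<forall>s\<in>{s1, s2, s3}. \<exists>z\<in>B t'. conn X z s) \<and>
        \<not> conn (X - B t') s1 s2 \<and> \<not> conn (X - B t') s1 s3 \<and> \<not> conn (X - B t') s2 s3"
      using A fn[OF r(1,2,5)] fn[OF r(1,3,6)] fn[OF r(2,3,7)]
      by (rule_tac bexI[OF _ f(1)[OF r(1)]], rule_tac bexI[OF _ f(1)[OF r(2)]],
          rule_tac bexI[OF _ f(1)[OF r(3)]]) simp
  next
    show "finite (T - {t})" "finite (S - {p})" using Suc.prems by auto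
  next
    fix t1 t2 assume "t1 \<in> T - {t}" "t2 \<in> T - {t}" "t1 \<noteq> t2"
    then show "B t1 \<inter> B t2 = {}" using disj by blast
  next
    fix t' assume "t' \<in> T - {t}"
    then show "B t' \<subseteq> X" "B t' \<inter> (S - {p}) = {}" using BX BS by blast+
  next
    fix t' u v assume "t' \<in> T - {t}" "u \<in> B t'" "v \<in> B t'"
    then show "conn (B t') u v" using Bc by blast
  qed
  then have "card T - 1 \<le> card S - 1" using ts(1) pq(1) Suc.prems(1,2) by simp
  moreover have "card S \<ge> 1" using pq(1) Suc.prems(2) by (metis One_nat_def Suc_leI card_gt_0_iff empty_iff)
  ultimately show ?case by simp
qed

section \<open>Infinite clusters and finite modifications\<close>

definition sites :: "config \<Rightarrow> bool \<Rightarrow> site set" where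
  "sites s a = {x. s x = a}"

definition inf_sites :: "site set \<Rightarrow> site set" where
  "inf_sites X = {u \<in> X. infinite {v. conn X u v}}"

definition two_inf :: "site set \<Rightarrow> bool" where
  "two_inf X \<longleftrightarrow> (\<exists>u\<in>inf_sites X. \<exists>v\<in>inf_sites X. \<not> conn X u v)"

definition three_inf :: "site set \<Rightarrow> bool" where
  "three_inf X \<longleftrightarrow> (\<exists>u\<in>inf_sites X. \<exists>v\<in>inf_sites X. \<exists>w\<in>inf_sites X.
     \<not> conn X u v \<and> \<not> conn X u w \<and> \<not> conn X v w)"

definition branch_ends :: "int \<Rightarrow> site \<Rightarrow> site set \<Rightarrow> site set" where
  "branch_ends n x X = {y \<in> inf_sites (X - sqbox x n). \<exists>z\<in>sqbox x n. nb z y}"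

definition trifurcation :: "int \<Rightarrow> site \<Rightarrow> site set \<Rightarrow> bool" where
  "trifurcation n x X \<longleftrightarrow> sqbox x n \<subseteq> X \<and>
    (\<exists>u\<in>branch_ends n x X. \<exists>v\<in>branch_ends n x X. \<exists>w\<in>branch_ends n x X.
      \<not> conn (X - sqbox x n) u v \<and> \<not> conn (X - sqbox x n) u w \<and> \<not> conn (X - sqbox x n) v w)"

lemma conn_infinite_cong:
  assumes "conn X u v" shows "{y. conn X u y} = {y. conn X v y}"
  using assms conn_sym conn_trans by blast

lemma inf_sites_conn: "u \<in> inf_sites X \<Longrightarrow> conn X u v \<Longrightarrow> v \<in> inf_sites X"
  using conn_infinite_cong[of X u v] conn_in[of X u v] by (simp add: inf_sites_def)

text \<open>Only finitely many pieces of \<open>X - B\<close> touch the finite set \<open>B\<close>,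
  and by last exits those in the cluster of \<open>u\<close> exhaust it outside \<open>B\<close>. If
  all were finite, the cluster would be finite.\<close>

lemma infinite_piece:
  assumes u: "u \<in> inf_sites X" "u \<in> B" and B: "finite B"
  shows "\<exists>w\<in>inf_sites (X - B). (\<exists>z\<in>B. nb z w) \<and> conn X u w"
proof (rule ccontr)
  assume neg: "\<not> ?thesis"
  define W where "W = {w \<in> X - B. (\<exists>z\<in>B. nb z w) \<and> conn X u w}"
  have "W \<subseteq> (\<Union>z\<in>B. sqbox z 1)" by (auto simp: W_def sqbox_def nb_def)
  then have "finite W" by (rule finite_subset) (use B in auto)
  moreover have "finite {v. conn (X - B) w v}" if "w \<in> W" for w
    using neg that unfolding W_def inf_sites_def by blast
  ultimately have "finite (\<Union>w\<in>W. {v. conn (X - B) w v})" by blast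
  moreover have "{v. conn X u v} - B \<subseteq> (\<Union>w\<in>W. {v. conn (X - B) w v})"
  proof
    fix v assume v: "v \<in> {v. conn X u v} - B"
    then obtain z0 z1 where z: "z0 \<in> B" "nb z0 z1" "z1 \<in> X - B" "conn (X - B) z1 v"
      using conn_last_exit[of X u v B] u(2) by blast
    have "conn X z1 v" using z(4) by (rule conn_mono) auto
    then have "conn X u z1" using v conn_sym conn_trans by blast
    then have "z1 \<in> W" using z by (auto simp: W_def)
    then show "v \<in> (\<Union>w\<in>W. {v. conn (X - B) w v})" using z(4) by blast
  qed
  ultimately have "finite ({v. conn X u v} - B)" by (rule rev_finite_subset)
  then have "finite {v. conn X u v}" using B by (metis Diff_infinite_finite)
  then show False using u(1) by (simp add: inf_sites_def)
qed

text \<open>A box meeting three infinite clusters leaves an infinite branch of each at its border.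
  Filling the box changes nothing outside it, so the branches remain separated there.\<close>

lemma trifurcation_exists:
  assumes "three_inf X" shows "\<exists>n. trifurcation n 0 (X \<union> sqbox 0 n)"
proof -
  obtain u1 u2 u3 where u: "u1 \<in> inf_sites X" "u2 \<in> inf_sites X" "u3 \<in> inf_sites X"
    "\<not> conn X u1 u2" "\<not> conn X u1 u3" "\<not> conn X u2 u3"
    using assms unfolding three_inf_def by blast
  obtain n where n: "{u1, u2, u3} \<subseteq> sqbox 0 n" using finite_subset_box[of "{u1, u2, u3}"] by blast
  let ?B = "sqbox 0 n"
  have "\<exists>w\<in>inf_sites (X - ?B). (\<exists>z\<in>?B. nb z w) \<and> conn X u w" if "u \<in> {u1, u2, u3}" for u
    by (rule infinite_piece) (use u n that in auto)
  then obtain w1 w2 w3 where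
    w: "\<forall>w\<in>{w1, w2, w3}. w \<in> inf_sites (X - ?B) \<and> (\<exists>z\<in>?B. nb z w)"
    and c: "conn X u1 w1" "conn X u2 w2" "conn X u3 w3" by simp metis
  have sep: "\<not> conn (X - ?B) w w'" if "conn X u w" "conn X u' w'" "\<not> conn X u u'" for w w' u u'
  proof
    assume "conn (X - ?B) w w'"
    then have "conn X w w'" by (rule conn_mono) auto
    then show False using that conn_sym conn_trans by blast
  qed
  have e: "(X \<union> ?B) - ?B = X - ?B" by auto
  have "trifurcation n 0 (X \<union> ?B)"
  proof -
    have "w1 \<in> branch_ends n 0 (X \<union> ?B)" "w2 \<in> branch_ends n 0 (X \<union> ?B)" "w3 \<in> branch_ends n 0 (X \<union> ?B)"
      using w by (simp_all add: branch_ends_def e)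
    then show ?thesis
      unfolding trifurcation_def e using sep[OF c(1,2) u(4)] sep[OF c(1,3) u(5)] sep[OF c(2,3) u(6)] by blast
  qed
  then show ?thesis by blast
qed

text \<open>An infinite cluster of the enlarged set that missed the box would be a third infinite
  cluster of \<open>X\<close>, as the box meets the other two. So all infinite clusters pass through
  the box, which is connected.\<close>

lemma merge:
  assumes "two_inf X" "\<not> three_inf X"
  shows "\<exists>n. \<not> two_inf (X \<union> sqbox 0 n)"
proof -
  obtain u1 u2 where u: "u1 \<in> inf_sites X" "u2 \<in> inf_sites X" "\<not> conn X u1 u2"
    using assms(1) unfolding two_inf_def by blast
  obtain n where n: "{u1, u2} \<subseteq> sqbox 0 n" using finite_subset_box[of "{u1, u2}"] by blast
  let ?X = "X \<union> sqbox 0 n"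
  have hit: "\<exists>b\<in>sqbox 0 n. conn ?X u b" if v: "u \<in> inf_sites ?X" for u
  proof (rule ccontr)
    assume neg: "\<not> ?thesis"
    have mono: "conn X u y" if "conn ?X u y" for y
      using that
    proof (rule conn_restrict)
      fix y assume "y \<in> ?X" "conn ?X u y" then show "y \<in> X" using neg by blast
    qed
    have "{y. conn ?X u y} \<subseteq> {y. conn X u y}" using mono by blast
    then have "infinite {y. conn X u y}" using v finite_subset unfolding inf_sites_def by blast
    moreover have "u \<in> X" using v neg conn_refl unfolding inf_sites_def by blast
    ultimately have "u \<in> inf_sites X" by (simp add: inf_sites_def)
    then have "conn X u1 u \<or> conn X u2 u"
      using assms(2) u unfolding three_inf_def by blast
    then have "conn ?X u1 u \<or> conn ?X u2 u" using conn_mono[of X _ u ?X] by blast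
    then show False using neg n conn_sym by blast
  qed
  have "conn ?X u v" if uv: "u \<in> inf_sites ?X" "v \<in> inf_sites ?X" for u v
  proof -
    obtain b b' where b: "b \<in> sqbox 0 n" "conn ?X u b" "b' \<in> sqbox 0 n" "conn ?X v b'"
      using hit[OF uv(1)] hit[OF uv(2)] by blast
    have "conn ?X b b'" by (rule conn_mono[OF conn_box[OF b(1,3)]]) auto
    then show ?thesis using b conn_sym conn_trans by blast
  qed
  then show ?thesis unfolding two_inf_def by blast
qed

section \<open>Trifurcations against the size of a sphere\<close>

definition mx :: "site \<Rightarrow> int" where "mx v = max \<bar>fst v\<bar> \<bar>snd v\<bar>"

lemma conn_hits_sphere:
  assumes "conn X u v" "mx u \<le> m" "m \<le> mx v"
  shows "\<exists>s. conn X u s \<and> mx s = m"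
  using assms(1,3)
proof (induction rule: conn_induct)
  case refl
  then show ?case using assms(2) conn_refl by (intro exI[of _ u]) auto
next
  case (step y z)
  show ?case
  proof (cases "m \<le> mx y")
    case False
    have "mx z \<le> mx y + 1" using \<open>nb y z\<close> by (cases rule: nb_cases) (auto simp: mx_def)
    then have "mx z = m" using False step.prems by auto
    moreover have "conn X u z" using step.hyps conn_edge conn_trans by blast
    ultimately show ?thesis by blast
  qed (use step.IH in blast)
qed

lemma finite_mx_le [simp]: "finite {v. mx v \<le> m}"
proof -
  have "{v. mx v \<le> m} \<subseteq> sqbox 0 m" by (auto simp: mx_def sqbox_def)
  then show ?thesis by (rule finite_subset) (rule finite_box)
qed

text \<open>Each of the four sides of the square has \<open>2 * m + 1\<close> sites; counting
  corners twice keeps the bound valid at \<open>m = 0\<close>.\<close>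

lemma card_sphere: "m \<ge> 0 \<Longrightarrow> finite {v. mx v = m} \<and> card {v. mx v = m} \<le> nat (8 * m + 4)"
proof -
  assume m: "m \<ge> 0"
  let ?A = "{-m, m} \<times> {-m..m} \<union> {-m..m} \<times> {-m, m}"
  have "(a, b) \<in> ?A" if "mx (a, b) = m" for a b
  proof -
    have "\<bar>a\<bar> \<le> m" "\<bar>b\<bar> \<le> m" "\<bar>a\<bar> = m \<or> \<bar>b\<bar> = m" using that by (simp_all add: mx_def max_def split: if_splits)
    then have "(a = m \<or> a = - m) \<and> - m \<le> b \<and> b \<le> m \<or> (b = m \<or> b = - m) \<and> - m \<le> a \<and> a \<le> m"
      by arith
    then show ?thesis by auto
  qed
  then have sub: "{v. mx v = m} \<subseteq> ?A" by (simp add: subset_iff)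
  have "card ?A \<le> card ({-m, m} \<times> {-m..m}) + card ({-m..m} \<times> {-m, m})" by (rule card_Un_le)
  also have "\<dots> \<le> 2 * nat (2 * m + 1) + nat (2 * m + 1) * 2"
  proof -
    have "card {-m, m} \<le> 2" by (simp add: card_insert_if)
    moreover have "card {-m..m} = nat (2 * m + 1)" by simp
    ultimately show ?thesis unfolding card_cartesian_product by (intro add_mono mult_mono) auto
  qed
  also have "\<dots> \<le> nat (8 * m + 4)" using m by auto
  finally have c: "card ?A \<le> nat (8 * m + 4)" .
  have "finite ?A" by auto
  with sub c show ?thesis by (meson card_mono finite_subset le_trans)
qed

text \<open>Infinite branches of a box inside the sphere of radius \<open>m\<close> must cross it,
  so the sphere serves as the set of branch witnesses in \<open>trifurcation_count\<close>.\<close>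

lemma trifurcation_box_count:
  assumes T: "finite T" "\<And>x y. x \<in> T \<Longrightarrow> y \<in> T \<Longrightarrow> x \<noteq> y \<Longrightarrow> sqbox x n \<inter> sqbox y n = {}"
    and m: "\<And>x. x \<in> T \<Longrightarrow> sqbox x n \<subseteq> {v. mx v < m}" "m \<ge> 0"
  shows "card {x \<in> T. trifurcation n x X} \<le> nat (8 * m + 4)"
proof -
  let ?S = "{v. mx v = m}"
  have "card {x \<in> T. trifurcation n x X} \<le> card ?S"
  proof (rule trifurcation_count[where B = "\<lambda>x. sqbox x n" and X = X])
    show "finite {x \<in> T. trifurcation n x X}" "finite ?S" using T card_sphere[OF m(2)] by auto
  next
    fix x assume x: "x \<in> {x \<in> T. trifurcation n x X}"
    let ?B = "sqbox x n"
    obtain w1 w2 w3 where BX: "?B \<subseteq> X" and w: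
        "\<forall>y\<in>{w1, w2, w3}. y \<in> inf_sites (X - ?B) \<and> (\<exists>z\<in>?B. nb z y)"
        "\<not> conn (X - ?B) w1 w2" "\<not> conn (X - ?B) w1 w3" "\<not> conn (X - ?B) w2 w3"
      using x unfolding trifurcation_def branch_ends_def by blast
    have "\<exists>s\<in>?S. conn (X - ?B) w s \<and> (\<exists>z\<in>?B. conn X z s)" if "w \<in> {w1, w2, w3}" for w
    proof -
      obtain z where z: "z \<in> ?B" "nb z w" and wi: "w \<in> inf_sites (X - ?B)" using bspec[OF w(1) \<open>w \<in> {w1, w2, w3}\<close>] by blast
      have "\<not> {v. conn (X - ?B) w v} \<subseteq> {v. mx v \<le> m}"
        using wi finite_subset[OF _ finite_mx_le] unfolding inf_sites_def by blast
      then obtain v where v: "conn (X - ?B) w v" "m < mx v" using not_le by blast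
      have "mx z < m" using z(1) m(1)[of x] x by auto
      moreover have "mx w \<le> mx z + 1" using z(2) by (cases rule: nb_cases) (auto simp: mx_def)
      ultimately obtain s where s: "conn (X - ?B) w s" "mx s = m"
        using conn_hits_sphere[OF v(1), of m] v(2) by auto
      have "conn X w s" using s(1) by (rule conn_mono) auto
      moreover have "conn X z w" using z wi BX by (intro conn_edge) (auto simp: inf_sites_def)
      ultimately show ?thesis using s z(1) conn_trans by blast
    qed
    then obtain s1 s2 s3 where s: "s1 \<in> ?S" "s2 \<in> ?S" "s3 \<in> ?S"
      "conn (X - ?B) w1 s1" "conn (X - ?B) w2 s2" "conn (X - ?B) w3 s3"
      "\<forall>s\<in>{s1, s2, s3}. \<exists>z\<in>?B. conn X z s" by simp metis
    have sep: "\<not> conn (X - ?B) s s'" if "conn (X - ?B) w s" "conn (X - ?B) w' s'" "\<not> conn (X - ?B) w w'"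
      for s s' w w' using that conn_sym conn_trans by blast
    show "\<exists>s1\<in>?S. \<exists>s2\<in>?S. \<exists>s3\<in>?S. (\<forall>s\<in>{s1, s2, s3}. \<exists>z\<in>?B. conn X z s) \<and>
        \<not> conn (X - ?B) s1 s2 \<and> \<not> conn (X - ?B) s1 s3 \<and> \<not> conn (X - ?B) s2 s3"
      using s(7) sep[OF s(4,5) w(2)] sep[OF s(4,6) w(3)] sep[OF s(5,6) w(4)]
      by (rule_tac bexI[OF _ s(1)], rule_tac bexI[OF _ s(2)], rule_tac bexI[OF _ s(3)]) simp
    show "?B \<subseteq> X" by (rule BX)
    show "?B \<inter> ?S = {}" using m(1)[of x] x by auto
    show "conn ?B u v" if "u \<in> ?B" "v \<in> ?B" for u v using that by (rule conn_box)
  next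
    fix x y assume "x \<in> {x \<in> T. trifurcation n x X}" "y \<in> {x \<in> T. trifurcation n x X}" "x \<noteq> y"
    then show "sqbox x n \<inter> sqbox y n = {}" using T(2) by blast
  qed
  then show ?thesis using card_sphere[OF m(2)] by linarith
qed

section \<open>The boundary between two infinite clusters\<close>

text \<open>With one infinite cluster of each sign this is the component, in the complement of the
  infinite cluster of spin \<open>a\<close>, that contains the other one. Leaving out the remaining
  components of that complement makes the complement of \<open>facing s a\<close> connected.\<close>

definition facing :: "config \<Rightarrow> bool \<Rightarrow> site set" where
  "facing s a = {x. \<exists>z\<in>inf_sites (sites s (\<not> a)). conn (- inf_sites (sites s a)) z x}"

definition face_sign :: "config \<Rightarrow> config \<Rightarrow> bool \<Rightarrow> bool \<Rightarrow> bool" where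
  "face_sign s t a b \<longleftrightarrow> (\<exists>w\<in>straddles (facing s a). t w = b)"

text \<open>Site \<open>(i, j)\<close> of the second field stands for the centre of the plaquette with lower-left
  corner \<open>(i, j)\<close> of the first, so the edge from \<open>(i, j)\<close> to \<open>(i + 1, j)\<close> is dual to the one from
  \<open>(i, j - 1)\<close> to \<open>(i, j)\<close>.\<close>

definition noncrossing :: "config \<Rightarrow> config \<Rightarrow> bool" where
  "noncrossing s t \<longleftrightarrow> (\<forall>i j. (s (i, j) \<noteq> s (i + 1, j) \<longrightarrow> t (i, j - 1) = t (i, j)) \<and>
                            (s (i, j) \<noteq> s (i, j + 1) \<longrightarrow> t (i - 1, j) = t (i, j)))"

lemma face_sign_ex1:
  assumes nc: "noncrossing s t"
    and inf: "inf_sites (sites s a) \<noteq> {}" "inf_sites (sites s (\<not> a)) \<noteq> {}"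
    and uniq: "\<not> two_inf (sites s a)" "\<not> two_inf (sites s (\<not> a))"
  shows "\<exists>!b. face_sign s t a b"
proof -
  define C where "C = inf_sites (sites s a)"
  define D where "D = inf_sites (sites s (\<not> a))"
  define K where "K = facing s a"
  have K_alt: "K = {x. \<exists>z\<in>D. conn (- C) z x}" by (simp add: K_def facing_def C_def D_def)
  have disj: "C \<inter> D = {}" by (auto simp: C_def D_def inf_sites_def sites_def)
  have KC: "K \<inter> C = {}"
  proof -
    have "x \<notin> C" if "z \<in> D" "conn (- C) z x" for x z
      using conn_in[OF that(2)] that(1) disj by blast
    then show ?thesis by (auto simp: K_alt)
  qed
  have Kstep: "y \<in> K" if "x \<in> K" "conn (- C) x y" for x y
    using that conn_trans unfolding K_alt by blast
  have DK: "D \<subseteq> K" unfolding K_alt using conn_refl by blast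
  have self: "conn I u v" if "u \<in> I" "v \<in> I" "I = inf_sites Z" "\<not> two_inf Z" for u v I Z
  proof -
    have "conn Z u v" using that unfolding two_inf_def by blast
    then show ?thesis
      by (rule conn_restrict) (use that inf_sites_conn in blast)
  qed
  have Kconn: "conn K u v" if "u \<in> K" "v \<in> K" for u v
  proof -
    obtain z where z1: "z \<in> D" "conn (- C) z u" using \<open>u \<in> K\<close> unfolding K_alt by blast
    obtain z' where z2: "z' \<in> D" "conn (- C) z' v" using \<open>v \<in> K\<close> unfolding K_alt by blast
    note z = z1 z2
    have "conn D z z'" by (rule self[OF z(1,3) D_def uniq(2)])
    then have "conn (- C) z z'" by (rule conn_mono) (use disj in auto)
    then have "conn (- C) u v" using z conn_sym conn_trans by blast
    then show ?thesis by (rule conn_restrict) (use Kstep that in blast)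
  qed
  obtain i0 where i0: "i0 \<in> C" using inf(1) C_def by blast
  have Cconn: "conn (- K) u v" if "u \<in> C" "v \<in> C" for u v
    by (rule conn_mono[OF self[OF that C_def uniq(1)]]) (use KC in auto)
  \<comment> \<open>A walk that starts outside \<open>K\<close> cannot enter \<open>K\<close> before
    it reaches \<open>C\<close>, because steps avoiding \<open>C\<close> preserve membership in
    \<open>K\<close>.\<close>
  have toC: "conn (- K) x i0" if "x \<notin> K" for x
  proof -
    have "conn UNIV x i0" by simp
    then show ?thesis using that
    proof (induction rule: conn_converse_induct)
      case (step y z)
      show ?case
      proof (cases "y \<in> C")
        case True
        then show ?thesis using Cconn i0 by blast
      next
        case False
        have "z \<notin> K"
        proof
          assume z: "z \<in> K"
          then have "conn (- C) z y" using KC False nb_sym[OF step.hyps(1)] by (intro conn_edge) auto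
          then show False using Kstep z step.prems by blast
        qed
        then have "conn (- K) y z" using step by (intro conn_edge) auto
        then show ?thesis using step.IH \<open>z \<notin> K\<close> conn_trans by blast
      qed
    qed simp
  qed
  have K'conn: "conn (- K) u v" if "u \<notin> K" "v \<notin> K" for u v
    using toC[OF that(1)] toC[OF that(2)] conn_sym conn_trans by blast
  \<comment> \<open>The outer endpoint of a boundary edge lies in \<open>C\<close>, or it would
    belong to \<open>K\<close>; the inner one has the opposite spin, or it would belong to
    \<open>C\<close>.\<close>
  have bd: "s x \<noteq> s y" if "nb x y" "x \<in> K" "y \<notin> K" for x y
  proof
    assume e: "s x = s y"
    have "x \<notin> C" using that KC by blast
    have "y \<in> C"
    proof (rule ccontr)
      assume "y \<notin> C"
      then have "conn (- C) x y" using that(1) \<open>x \<notin> C\<close> by (intro conn_edge) auto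
      then show False using Kstep that by blast
    qed
    then have "conn (sites s a) y x"
      using e nb_sym[OF that(1)] by (intro conn_edge) (auto simp: C_def inf_sites_def sites_def)
    then show False using inf_sites_conn \<open>y \<in> C\<close> \<open>x \<notin> C\<close> C_def by blast
  qed
  have bd': "s x \<noteq> s y" if "nb x y" "(x \<in> K) \<noteq> (y \<in> K)" for x y
    using bd[of x y] bd[of y x] that nb_sym by metis
  have const: "t w' = t w" if "w \<in> straddles K" "w' \<in> straddles K" for w w'
  proof (rule boundary_const[OF Kconn K'conn _ _ that])
    fix i j assume "((i, j) \<in> K) \<noteq> ((i + 1, j) \<in> K)"
    then have "s (i, j) \<noteq> s (i + 1, j)" using bd'[of "(i,j)" "(i+1,j)"] by (simp add: nb_def)
    then show "t (i, j - 1) = t (i, j)" using nc unfolding noncrossing_def by blast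
  next
    fix i j assume "((i, j) \<in> K) \<noteq> ((i, j + 1) \<in> K)"
    then have "s (i, j) \<noteq> s (i, j + 1)" using bd'[of "(i,j)" "(i,j+1)"] by (simp add: nb_def)
    then show "t (i - 1, j) = t (i, j)" using nc unfolding noncrossing_def by blast
  qed
  obtain d0 where "d0 \<in> D" using inf(2) D_def by blast
  then have "straddles K \<noteq> {}" using straddles_nonempty[of d0 K i0] DK i0 KC by blast
  then show ?thesis using const unfolding face_sign_def K_def[symmetric] by blast
qed

section \<open>Translations and measurability\<close>

declare split_paired_All [simp del] split_paired_Ex [simp del]

lemma sites_shift: "sites (shift t s) a = (\<lambda>x. x + t) -` sites s a"
  by (auto simp: sites_def shift_apply)

lemma sites_flip: "sites (flip s) a = sites s (\<not> a)"
  by (auto simp: sites_def flip_def)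

lemma vimage_translate: "(\<lambda>x. x + t) -` A = (\<lambda>x. x - t) ` (A :: site set)"
proof (intro set_eqI iffI)
  fix x assume "x \<in> (\<lambda>x. x + t) -` A"
  then show "x \<in> (\<lambda>x. x - t) ` A" by (intro image_eqI[of _ _ "x + t"]) auto
qed auto

lemma vimage_translate_subset: "(\<lambda>x. x + t) -` A \<subseteq> (\<lambda>x. x + t) -` B \<longleftrightarrow> A \<subseteq> (B :: site set)"
  unfolding vimage_translate by (rule inj_image_subset_iff) (simp add: inj_def)

lemma finite_translate: "finite ((\<lambda>x. x + t) -` A) \<longleftrightarrow> finite (A :: site set)"
  unfolding vimage_translate by (rule finite_image_iff) (simp add: inj_on_def)

lemma inf_sites_translate: "inf_sites ((\<lambda>x. x + t) -` X) = (\<lambda>x. x + t) -` inf_sites X"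
proof -
  have "finite {v. conn X (u + t) (v + t)} = finite {v. conn X (u + t) v}" for u
    using finite_translate[of t "{v. conn X (u + t) v}"] by simp
  then show ?thesis unfolding inf_sites_def conn_translate by simp
qed

lemma two_inf_translate: "two_inf ((\<lambda>x. x + t) -` X) = two_inf X"
  unfolding two_inf_def inf_sites_translate conn_translate
  unfolding vimage_translate by simp

lemma three_inf_translate: "three_inf ((\<lambda>x. x + t) -` X) = three_inf X"
  unfolding three_inf_def inf_sites_translate conn_translate
  unfolding vimage_translate by simp

lemma sqbox_translate: "sqbox x n = (\<lambda>x. x + t) -` sqbox (x + t) n"
  by (auto simp: sqbox_def)

lemma trifurcation_translate: "trifurcation n x ((\<lambda>x. x + t) -` X) = trifurcation n (x + t) X"
proof -
  let ?B = "sqbox (x + t) n"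
  have B: "sqbox x n = (\<lambda>x. x + t) -` ?B" by (rule sqbox_translate)
  have d: "(\<lambda>x. x + t) -` X - (\<lambda>x. x + t) -` ?B = (\<lambda>x. x + t) -` (X - ?B)" by auto
  have n: "(\<exists>z\<in>(\<lambda>x. x + t) -` ?B. nb z y) \<longleftrightarrow> (\<exists>z\<in>?B. nb z (y + t))" for y
    unfolding vimage_translate by (simp add: nb_def algebra_simps)
  have "branch_ends n x ((\<lambda>x. x + t) -` X) = (\<lambda>x. x + t) -` branch_ends n (x + t) X"
    unfolding branch_ends_def B d n inf_sites_translate by auto
  then show ?thesis
    unfolding trifurcation_def B d conn_translate vimage_translate_subset
    unfolding vimage_translate by simp
qed

lemma facing_shift: "facing (shift t s) a = (\<lambda>x. x + t) -` facing s a"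
proof -
  have c: "- (\<lambda>x. x + t) -` X = (\<lambda>x. x + t) -` (- X)" for X :: "site set" by auto
  have "(\<exists>z\<in>(\<lambda>x. x + t) -` A. conn X (z + t) y) \<longleftrightarrow> (\<exists>z\<in>A. conn X z y)" for A X y
    unfolding vimage_translate by simp
  then show ?thesis
    unfolding facing_def sites_shift inf_sites_translate c conn_translate by auto
qed

lemma straddles_translate: "straddles ((\<lambda>x. x + t) -` K) = (\<lambda>x. x + t) -` straddles K"
  by (cases t) (auto simp: straddles_def ac_simps)

lemma face_sign_shift: "face_sign (shift t s) (shift t s') a b = face_sign s s' a b"
  unfolding face_sign_def facing_shift straddles_translate
  unfolding vimage_translate by (simp add: shift_apply)

lemma facing_flip: "facing (flip s) a = facing s (\<not> a)"
  by (simp add: facing_def sites_flip)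

lemma face_sign_flip1: "face_sign (flip s) t a b = face_sign s t (\<not> a) b"
  by (simp add: face_sign_def facing_flip)

lemma face_sign_flip2: "face_sign s (flip t) a b = face_sign s t a (\<not> b)"
  by (auto simp: face_sign_def flip_def)

section \<open>Measurability of connectivity events\<close>

lemma pred_conn:
  assumes X: "\<And>v. Measurable.pred M (\<lambda>w. v \<in> X w)"
  shows "Measurable.pred M (\<lambda>w. conn (X w) u v)"
proof -
  define R where "R n v w \<longleftrightarrow> ((\<lambda>x y. nb x y \<and> x \<in> X w \<and> y \<in> X w) ^^ n) u v" for n v w
  have R: "Measurable.pred M (R n v)" for n v
  proof (induction n arbitrary: v)
    case 0
    then show ?case by (simp add: R_def)
  next
    case (Suc n)
    have "R (Suc n) v = (\<lambda>w. \<exists>y. R n y w \<and> nb y v \<and> y \<in> X w \<and> v \<in> X w)"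
      by (auto simp: R_def fun_eq_iff)
    then show ?case using Suc X by simp
  qed
  have "(\<lambda>w. conn (X w) u v) = (\<lambda>w. \<exists>n. R n v w)"
    by (auto simp: conn_def R_def rtranclp_power fun_eq_iff)
  then show ?thesis using R by simp
qed

text \<open>Unboundedness is a countable combination of membership statements, the form in which
  infinitude is seen to be measurable.\<close>

lemma infinite_site_iff: "infinite A \<longleftrightarrow> (\<forall>n::nat. \<exists>v. v \<in> A \<and> int n < mx v)"
proof
  assume "infinite A"
  then have "\<not> A \<subseteq> {v. mx v \<le> int n}" for n by (metis finite_mx_le finite_subset)
  then show "\<forall>n::nat. \<exists>v. v \<in> A \<and> int n < mx v" by (meson mem_Collect_eq not_le subsetI)
next
  assume r: "\<forall>n::nat. \<exists>v. v \<in> A \<and> int n < mx v"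
  show "infinite A"
  proof
    assume "finite A"
    then obtain n where n: "A \<subseteq> sqbox 0 n" using finite_subset_box by blast
    obtain v where v: "v \<in> A" "int (nat n) < mx v" using r by blast
    then have "mx v \<le> n" using n by (auto simp: sqbox_def mx_def)
    then show False using v(2) by linarith
  qed
qed

lemma pred_inf_sites:
  assumes X: "\<And>v. Measurable.pred M (\<lambda>w. v \<in> X w)"
  shows "Measurable.pred M (\<lambda>w. v \<in> inf_sites (X w))"
  unfolding inf_sites_def mem_Collect_eq infinite_site_iff using X pred_conn[OF X] by simp

lemma pred_two_inf:
  assumes X: "\<And>v. Measurable.pred M (\<lambda>w. v \<in> X w)"
  shows "Measurable.pred M (\<lambda>w. two_inf (X w))"
  unfolding two_inf_def Bex_def using pred_inf_sites[where X = X, OF X] pred_conn[where X = X, OF X] by simp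

lemma pred_three_inf:
  assumes X: "\<And>v. Measurable.pred M (\<lambda>w. v \<in> X w)"
  shows "Measurable.pred M (\<lambda>w. three_inf (X w))"
  unfolding three_inf_def Bex_def using pred_inf_sites[where X = X, OF X] pred_conn[where X = X, OF X] by simp

lemma pred_trifurcation:
  assumes X: "\<And>v. Measurable.pred M (\<lambda>w. v \<in> X w)"
  shows "Measurable.pred M (\<lambda>w. trifurcation n x (X w))"
proof -
  have D: "Measurable.pred M (\<lambda>w. v \<in> X w - sqbox x n)" for v using X by simp
  note [measurable] = X pred_inf_sites[where X = "\<lambda>w. X w - sqbox x n", OF D]
    pred_conn[where X = "\<lambda>w. X w - sqbox x n", OF D]
  show ?thesis unfolding trifurcation_def branch_ends_def Bex_def subset_iff by simp
qed

lemma pred_face_sign: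
  assumes S: "\<And>v. Measurable.pred M (\<lambda>w. s w v)" and T: "\<And>v. Measurable.pred M (\<lambda>w. t w v)"
  shows "Measurable.pred M (\<lambda>w. face_sign (s w) (t w) a b)"
proof -
  have sites: "Measurable.pred M (\<lambda>w. v \<in> sites (s w) a)" for v a
    unfolding sites_def using S by simp
  note [measurable] = S T
  have [measurable]: "Measurable.pred M (\<lambda>w. v \<in> inf_sites (sites (s w) a))" for v a
    by (rule pred_inf_sites[OF sites])
  have "Measurable.pred M (\<lambda>w. v \<in> - inf_sites (sites (s w) a))" for v
    by simp
  then have [measurable]: "Measurable.pred M (\<lambda>w. conn (- inf_sites (sites (s w) a)) u v)" for u v
    by (rule pred_conn)
  have [measurable]: "Measurable.pred M (\<lambda>w. v \<in> facing (s w) a)" for v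
    unfolding facing_def Bex_def by simp
  have [measurable]: "Measurable.pred M (\<lambda>w. v \<in> straddles (facing (s w) a))" for v
    unfolding straddles_def by (cases v) auto
  show ?thesis unfolding face_sign_def Bex_def by simp
qed

section \<open>Spins on the faces of the two contour lattices\<close>

text \<open>Sites \<open>(i, j)\<close> index the faces of \<open>L1\<close>, with lower-left corner \<open>l1v (2 * i) (2 * j)\<close>.
  The letters refer to the step between faces: \<open>hedge i j\<close> is the vertical side between
  \<open>(i, j)\<close> and \<open>(i + 1, j)\<close>, and \<open>vedge i j\<close> the horizontal side between \<open>(i, j)\<close> and \<open>(i, j + 1)\<close>.\<close>

definition hedge :: "int \<Rightarrow> int \<Rightarrow> (real \<times> real) set" where
  "hedge i j = {l1v (2 * i + 2) (2 * j), l1v (2 * i + 2) (2 * j + 2)}"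

definition vedge :: "int \<Rightarrow> int \<Rightarrow> (real \<times> real) set" where
  "vedge i j = {l1v (2 * i) (2 * j + 2), l1v (2 * i + 2) (2 * j + 2)}"

lemma L1_face_sides_edges:
  "L1_face_sides (2 * i) (2 * j) = {vedge i (j - 1), hedge i j, vedge i j, hedge (i - 1) j}"
  unfolding L1_face_sides_def vedge_def hedge_def by (simp add: insert_commute algebra_simps)

text \<open>A field built from primal edges alone is needed because (A4) concerns their law. For
  arbitrary \<open>\<psi>\<close> the form need not be closed and the formula is a mere default;
  closedness is assumed where it matters.\<close>

definition lift_of :: "((real \<times> real) set \<Rightarrow> bool) \<Rightarrow> config" where
  "lift_of \<psi> = potential (\<lambda>(i, j). \<psi> (hedge i j)) (\<lambda>(i, j). \<psi> (vedge i j))"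

text \<open>The black faces with lower-left corners \<open>(2 * i + 1, 2 * j + 1)\<close> and
  \<open>(2 * i, 2 * j + 2)\<close> are those centred on \<open>hedge i j\<close> and
  \<open>vedge i j\<close>.\<close>

definition lift :: "config \<Rightarrow> config" where
  "lift \<omega> = potential (\<lambda>(i, j). vwall \<omega> (2 * i + 1) (2 * j + 1)) (\<lambda>(i, j). hwall \<omega> (2 * i) (2 * j + 2))"

lemma l1v_eq_iff [simp]: "l1v a b = l1v c d \<longleftrightarrow> a = c \<and> b = d"
  by (auto simp: l1v_def)

lemma hedge_eq_iff: "hedge i j = hedge i' j' \<longleftrightarrow> i = i' \<and> j = j'"
  unfolding hedge_def doubleton_eq_iff by auto

lemma vedge_eq_iff: "vedge i j = vedge i' j' \<longleftrightarrow> i = i' \<and> j = j'"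
  unfolding vedge_def doubleton_eq_iff by auto

lemma hedge_neq_vedge: "hedge i j \<noteq> vedge i' j'"
  unfolding hedge_def vedge_def doubleton_eq_iff by auto

lemma l1v_in: "even m \<Longrightarrow> even n \<Longrightarrow> l1v m n \<in> L1_verts"
  unfolding L1_verts_def by blast

lemma hedge_in: "hedge i j \<in> L1_edges"
proof -
  have "dist (l1v (2 * i + 2) (2 * j)) (l1v (2 * i + 2) (2 * j + 2)) = 2"
    by (simp add: l1v_def dist_prod_def dist_real_def)
  moreover have "l1v (2 * i + 2) (2 * j) \<in> L1_verts" "l1v (2 * i + 2) (2 * j + 2) \<in> L1_verts"
    by (simp_all add: l1v_in)
  ultimately show ?thesis unfolding L1_edges_def hedge_def by blast
qed

lemma vedge_in: "vedge i j \<in> L1_edges"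
proof -
  have "dist (l1v (2 * i) (2 * j + 2)) (l1v (2 * i + 2) (2 * j + 2)) = 2"
    by (simp add: l1v_def dist_prod_def dist_real_def)
  moreover have "l1v (2 * i) (2 * j + 2) \<in> L1_verts" "l1v (2 * i + 2) (2 * j + 2) \<in> L1_verts"
    by (simp_all add: l1v_in)
  ultimately show ?thesis unfolding L1_edges_def vedge_def by blast
qed

text \<open>In halved coordinates, length 2 says that two integer squares sum to 1, which leaves
  only unit steps.\<close>

lemma L1_edges_cases:
  assumes "e \<in> L1_edges"
  obtains i j where "e = hedge i j" | i j where "e = vedge i j"
proof -
  obtain p q where pq: "e = {p, q}" "p \<in> L1_verts" "q \<in> L1_verts" "dist p q = 2"
    using assms unfolding L1_edges_def by blast
  obtain m n where "p = l1v m n" "even m" "even n" using pq(2) unfolding L1_verts_def by blast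
  then obtain a b where p: "p = l1v (2 * a) (2 * b)" by (metis evenE)
  obtain m n where "q = l1v m n" "even m" "even n" using pq(3) unfolding L1_verts_def by blast
  then obtain c d where q: "q = l1v (2 * c) (2 * d)" by (metis evenE)
  have "sqrt ((2 * real_of_int a - 2 * real_of_int c)\<^sup>2 + (2 * real_of_int b - 2 * real_of_int d)\<^sup>2) = 2"
    using pq(4) by (simp add: p q l1v_def dist_prod_def dist_real_def)
  then have "(2 * real_of_int a - 2 * real_of_int c)\<^sup>2 + (2 * real_of_int b - 2 * real_of_int d)\<^sup>2 = 4"
    by (metis real_sqrt_eq_iff real_sqrt_four)
  then have "(real_of_int a - real_of_int c)\<^sup>2 + (real_of_int b - real_of_int d)\<^sup>2 = 1"
    by (simp add: power2_eq_square algebra_simps)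
  then have "real_of_int ((a - c)\<^sup>2 + (b - d)\<^sup>2) = real_of_int 1"
    by simp
  then have sq: "(a - c)\<^sup>2 + (b - d)\<^sup>2 = 1" by (simp only: of_int_eq_iff)
  have "nb (a, b) (c, d)"
  proof -
    have "\<bar>x\<bar> + \<bar>y\<bar> = 1" if h: "x\<^sup>2 + y\<^sup>2 = 1" for x y :: int
    proof -
      have "x\<^sup>2 \<le> 1" "y\<^sup>2 \<le> 1" using h zero_le_power2[of x] zero_le_power2[of y] by linarith+
      then have "\<bar>x\<bar> \<le> 1" "\<bar>y\<bar> \<le> 1" by (simp_all add: abs_square_le_1)
      then have "x \<in> {-1, 0, 1}" "y \<in> {-1, 0, 1}" by auto
      then show ?thesis using h by auto
    qed
    from this[OF sq] show ?thesis by (simp add: nb_def)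
  qed
  then show thesis
  proof (cases rule: nb_cases)
    case (1 i j)
    then have "e = vedge i (j - 1)" by (auto simp: pq(1) p q vedge_def algebra_simps)
    then show thesis using that by blast
  next
    case (2 i j)
    then have "e = vedge i (j - 1)" by (auto simp: pq(1) p q vedge_def algebra_simps)
    then show thesis using that by blast
  next
    case (3 i j)
    then have "e = hedge (i - 1) j" by (auto simp: pq(1) p q hedge_def algebra_simps)
    then show thesis using that by blast
  next
    case (4 i j)
    then have "e = hedge (i - 1) j" by (auto simp: pq(1) p q hedge_def algebra_simps)
    then show thesis using that by blast
  qed
qed

lemma phi1_pair:
  assumes "midpoint p q = face_center m n" "black m n"
  shows "phi1 \<omega> {p, q} \<longleftrightarrow> (if snd p = snd q then hwall \<omega> m n else vwall \<omega> m n)"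
proof -
  have fc: "face_center m n = face_center m' n' \<longleftrightarrow> m' = m \<and> n' = n" for m' n'
    by (auto simp: face_center_def)
  have mc: "midpoint q p = midpoint p q" by (rule midpoint_sym)
  show ?thesis unfolding phi1_def doubleton_eq_iff using assms fc mc by metis
qed

lemma phi1_hedge: "phi1 \<omega> (hedge i j) = vwall \<omega> (2 * i + 1) (2 * j + 1)"
  unfolding hedge_def
  by (subst phi1_pair[of _ _ "2 * i + 1" "2 * j + 1"])
    (auto simp: l1v_def face_center_def black_def midpoint_def algebra_simps)

lemma phi1_vedge: "phi1 \<omega> (vedge i j) = hwall \<omega> (2 * i) (2 * j + 2)"
  unfolding vedge_def
  by (subst phi1_pair[of _ _ "2 * i" "2 * j + 2"])
    (auto simp: l1v_def face_center_def black_def midpoint_def algebra_simps)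

lemma lift_of_phi1_cfg: "lift_of (phi1_cfg \<omega>) = lift \<omega>"
  unfolding lift_of_def lift_def phi1_cfg_def by (simp add: hedge_in vedge_in phi1_hedge phi1_vedge)

text \<open>Every allowed pattern is constant along rows or along columns, so one pair of
  neighbouring corners decides whether a wall is present.\<close>

lemma Omega_wall:
  assumes "\<omega> \<in> Omega" "even (m + n)"
  shows "vwall \<omega> m n \<longleftrightarrow> \<omega> (m, n) \<noteq> \<omega> (m + 1, n)"
    "vwall \<omega> m n \<longleftrightarrow> \<omega> (m, n + 1) \<noteq> \<omega> (m + 1, n + 1)"
    "hwall \<omega> m n \<longleftrightarrow> \<omega> (m, n) \<noteq> \<omega> (m, n + 1)"
    "hwall \<omega> m n \<longleftrightarrow> \<omega> (m + 1, n) \<noteq> \<omega> (m + 1, n + 1)"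
proof -
  have "(\<omega> (m,n), \<omega> (m,n+1), \<omega> (m+1,n+1), \<omega> (m+1,n)) \<in> allowed"
    using assms unfolding Omega_def black_def by blast
  then show "vwall \<omega> m n \<longleftrightarrow> \<omega> (m, n) \<noteq> \<omega> (m + 1, n)"
    "vwall \<omega> m n \<longleftrightarrow> \<omega> (m, n + 1) \<noteq> \<omega> (m + 1, n + 1)"
    "hwall \<omega> m n \<longleftrightarrow> \<omega> (m, n) \<noteq> \<omega> (m, n + 1)"
    "hwall \<omega> m n \<longleftrightarrow> \<omega> (m + 1, n) \<noteq> \<omega> (m + 1, n + 1)"
    unfolding allowed_def vwall_def hwall_def by auto
qed

lemma Omega_vwall_row:
  assumes "\<omega> \<in> Omega" "even (m + n)" "q = n \<or> q = n + 1"
  shows "vwall \<omega> m n \<longleftrightarrow> \<omega> (m, q) \<noteq> \<omega> (m + 1, q)"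
  using Omega_wall(1,2)[OF assms(1,2)] assms(3) by auto

lemma Omega_hwall_column:
  assumes "\<omega> \<in> Omega" "even (m + n)" "p = m \<or> p = m + 1"
  shows "hwall \<omega> m n \<longleftrightarrow> \<omega> (p, n) \<noteq> \<omega> (p, n + 1)"
  using Omega_wall(3,4)[OF assms(1,2)] assms(3) by auto

lemma wall_excl: "\<not> (vwall \<omega> m n \<and> hwall \<omega> m n)"
  unfolding vwall_def hwall_def by auto

lemma wall_shift: "vwall (shift (a, b) \<omega>) m n = vwall \<omega> (m + a) (n + b)"
    "hwall (shift (a, b) \<omega>) m n = hwall \<omega> (m + a) (n + b)"
  by (simp_all add: vwall_def hwall_def shift_def algebra_simps)

lemma lift_flip: "lift (flip \<omega>) = lift \<omega>"
proof -
  have "vwall (flip \<omega>) = vwall \<omega>" "hwall (flip \<omega>) = hwall \<omega>"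
    by (auto simp: fun_eq_iff vwall_def hwall_def flip_def)
  then show ?thesis by (simp add: lift_def)
qed

lemma Omega_shift: "even (a + b) \<Longrightarrow> shift (a, b) \<omega> \<in> Omega \<longleftrightarrow> \<omega> \<in> Omega"
proof -
  have *: "shift (a, b) \<omega> \<in> Omega" if "\<omega> \<in> Omega" "even (a + b)" for a b \<omega>
    unfolding Omega_def
  proof (intro CollectI allI impI)
    fix m n assume "black m n"
    then have "black (m + a) (n + b)" using that(2) by (auto simp: black_def)
    then show "(shift (a, b) \<omega> (m, n), shift (a, b) \<omega> (m, n + 1), shift (a, b) \<omega> (m + 1, n + 1),
         shift (a, b) \<omega> (m + 1, n)) \<in> allowed"
      using that(1)[unfolded Omega_def, THEN CollectD, rule_format, of "m + a" "n + b"]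
      by (simp add: shift_def algebra_simps)
  qed
  assume e: "even (a + b)"
  have "shift (-a, -b) (shift (a, b) \<omega>) = \<omega>" by (simp add: shift_def fun_eq_iff)
  then show ?thesis using *[of \<omega> a b] *[of "shift (a, b) \<omega>" "-a" "-b"] e by auto
qed

lemma Omega_flip: "flip \<omega> \<in> Omega \<longleftrightarrow> \<omega> \<in> Omega"
proof -
  have *: "flip \<omega> \<in> Omega" if "\<omega> \<in> Omega" for \<omega>
    using that unfolding Omega_def allowed_def flip_def by auto
  from *[of \<omega>] *[of "flip \<omega>"] show ?thesis by auto
qed

text \<open>The four \<open>L1\<close> edges at a vertex cross the sides of the white face centred
  there. A wall is present iff the state changes along the side it crosses, and a tour of the face
  meets an even number of changes.\<close>

lemma is_pot_lift:
  assumes "\<omega> \<in> Omega"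
  shows "is_pot (\<lambda>(i, j). vwall \<omega> (2 * i + 1) (2 * j + 1)) (\<lambda>(i, j). hwall \<omega> (2 * i) (2 * j + 2)) (lift \<omega>)"
  unfolding lift_def
proof (rule is_pot_potential, unfold closed_form_def, intro allI)
  fix i j
  have "vwall \<omega> (2*i+1) (2*j+1) \<longleftrightarrow> \<omega> (2*i+1, 2*j+2) \<noteq> \<omega> (2*i+2, 2*j+2)"
    using Omega_wall(2)[OF assms, of "2*i+1" "2*j+1"] by (simp add: algebra_simps)
  moreover have "vwall \<omega> (2*i+1) (2*(j+1)+1) \<longleftrightarrow> \<omega> (2*i+1, 2*j+3) \<noteq> \<omega> (2*i+2, 2*j+3)"
    using Omega_wall(1)[OF assms, of "2*i+1" "2*j+3"] by (simp add: algebra_simps)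
  moreover have "hwall \<omega> (2*i) (2*j+2) \<longleftrightarrow> \<omega> (2*i+1, 2*j+2) \<noteq> \<omega> (2*i+1, 2*j+3)"
    using Omega_wall(4)[OF assms, of "2*i" "2*j+2"] by (simp add: algebra_simps)
  moreover have "hwall \<omega> (2*(i+1)) (2*j+2) \<longleftrightarrow> \<omega> (2*i+2, 2*j+2) \<noteq> \<omega> (2*i+2, 2*j+3)"
    using Omega_wall(3)[OF assms, of "2*i+2" "2*j+2"] by (simp add: algebra_simps)
  ultimately show "((\<lambda>(i, j). vwall \<omega> (2 * i + 1) (2 * j + 1)) (i, j) = (\<lambda>(i, j). vwall \<omega> (2 * i + 1) (2 * j + 1)) (i, j + 1)) =
    ((\<lambda>(i, j). hwall \<omega> (2 * i) (2 * j + 2)) (i, j) = (\<lambda>(i, j). hwall \<omega> (2 * i) (2 * j + 2)) (i + 1, j))"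
    by auto
qed

lemma lift_step:
  assumes "\<omega> \<in> Omega"
  shows "lift \<omega> (i, j) \<noteq> lift \<omega> (i + 1, j) \<longleftrightarrow> vwall \<omega> (2 * i + 1) (2 * j + 1)"
    "lift \<omega> (i, j) \<noteq> lift \<omega> (i, j + 1) \<longleftrightarrow> hwall \<omega> (2 * i) (2 * j + 2)"
  using is_pot_lift[OF assms] unfolding is_pot_def by auto

text \<open>Both fields are potentials of the walls of the shifted configuration. The sign stays
  open because the translation moves the face of normalisation.\<close>

lemma lift_shift:
  assumes "\<omega> \<in> Omega"
  shows "lift (shift (2 * a, 2 * b) \<omega>) = shift (a, b) (lift \<omega>) \<or>
    lift (shift (2 * a, 2 * b) \<omega>) = flip (shift (a, b) (lift \<omega>))"
proof (rule is_pot_unique)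
  have "shift (2 * a, 2 * b) \<omega> \<in> Omega" using assms Omega_shift[of "2 * a" "2 * b"] by simp
  from is_pot_lift[OF this] show "is_pot (\<lambda>(i, j). vwall (shift (2 * a, 2 * b) \<omega>) (2 * i + 1) (2 * j + 1))
    (\<lambda>(i, j). hwall (shift (2 * a, 2 * b) \<omega>) (2 * i) (2 * j + 2)) (lift (shift (2 * a, 2 * b) \<omega>))" .
  show "is_pot (\<lambda>(i, j). vwall (shift (2 * a, 2 * b) \<omega>) (2 * i + 1) (2 * j + 1))
    (\<lambda>(i, j). hwall (shift (2 * a, 2 * b) \<omega>) (2 * i) (2 * j + 2)) (shift (a, b) (lift \<omega>))"
    unfolding is_pot_def
    using lift_step(1)[OF assms, of "_ + a" "_ + b"] lift_step(2)[OF assms, of "_ + a" "_ + b"]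
    by (simp add: shift_apply wall_shift algebra_simps)
qed

section \<open>The second field and the decomposition of the states\<close>

definition dual_lift :: "config \<Rightarrow> config" where
  "dual_lift \<omega> = lift (shift (1, 1) \<omega>)"

lemma dual_lift_step:
  assumes "\<omega> \<in> Omega"
  shows "dual_lift \<omega> (i, j) \<noteq> dual_lift \<omega> (i + 1, j) \<longleftrightarrow> vwall \<omega> (2 * i + 2) (2 * j + 2)"
    "dual_lift \<omega> (i, j) \<noteq> dual_lift \<omega> (i, j + 1) \<longleftrightarrow> hwall \<omega> (2 * i + 1) (2 * j + 3)"
proof -
  have "shift (1, 1) \<omega> \<in> Omega" using assms Omega_shift[of 1 1] by simp
  from lift_step[OF this, of i j] show
    "dual_lift \<omega> (i, j) \<noteq> dual_lift \<omega> (i + 1, j) \<longleftrightarrow> vwall \<omega> (2 * i + 2) (2 * j + 2)"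
    "dual_lift \<omega> (i, j) \<noteq> dual_lift \<omega> (i, j + 1) \<longleftrightarrow> hwall \<omega> (2 * i + 1) (2 * j + 3)"
    by (simp_all add: dual_lift_def wall_shift algebra_simps)
qed

text \<open>A step of one field and the dual step of the other are governed by the same black face,
  which carries at most one of its two walls.\<close>

lemma noncrossing_lift:
  assumes "\<omega> \<in> Omega" shows "noncrossing (lift \<omega>) (dual_lift \<omega>)"
  unfolding noncrossing_def
proof (intro allI conjI impI)
  fix i j assume "lift \<omega> (i, j) \<noteq> lift \<omega> (i + 1, j)"
  then have "vwall \<omega> (2 * i + 1) (2 * j + 1)" using lift_step(1)[OF assms] by blast
  then have "\<not> hwall \<omega> (2 * i + 1) (2 * j + 1)" using wall_excl by blast
  then show "dual_lift \<omega> (i, j - 1) = dual_lift \<omega> (i, j)"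
    using dual_lift_step(2)[OF assms, of i "j - 1"] by (simp add: algebra_simps)
next
  fix i j assume "lift \<omega> (i, j) \<noteq> lift \<omega> (i, j + 1)"
  then have "hwall \<omega> (2 * i) (2 * j + 2)" using lift_step(2)[OF assms] by blast
  then have "\<not> vwall \<omega> (2 * i) (2 * j + 2)" using wall_excl by blast
  then show "dual_lift \<omega> (i - 1, j) = dual_lift \<omega> (i, j)"
    using dual_lift_step(1)[OF assms, of "i - 1" j] by (simp add: algebra_simps)
qed

text \<open>The \<open>L1\<close> face containing \<open>v\<close>: face \<open>(i, j)\<close> holds
  the columns \<open>2 * i\<close>, \<open>2 * i + 1\<close> and the rows \<open>2 * j + 1\<close>,
  \<open>2 * j + 2\<close>. The \<open>L2\<close> faces in \<open>dual_face\<close> are displaced by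
  (1,1).\<close>

definition primal_face :: "site \<Rightarrow> site" where
  "primal_face v = (fst v div 2, (snd v - 1) div 2)"

definition dual_face :: "site \<Rightarrow> site" where
  "dual_face v = ((fst v - 1) div 2, (snd v - 2) div 2)"

definition offset :: "config \<Rightarrow> bool" where
  "offset \<omega> = (\<omega> 0 = (lift \<omega> (primal_face 0) = dual_lift \<omega> (dual_face 0)))"

text \<open>An edge of \<open>G\<close> leads to a new face in exactly one of the two lattices, and
  the state changes along it iff the wall between these faces is present. Hence the equation holds
  at all vertices or at none; which of the two depends on the normalisations and is recorded by
  \<open>offset\<close>.\<close>

lemma lift_decomposition:
  assumes "\<omega> \<in> Omega"
  shows "(\<omega> v = (lift \<omega> (primal_face v) = dual_lift \<omega> (dual_face v))) = offset \<omega>"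
  unfolding offset_def
proof (rule unit_invariant_const[of "\<lambda>v. \<omega> v = (lift \<omega> (primal_face v) = dual_lift \<omega> (dual_face v))"])
  fix p q :: int
  show "(\<omega> (p + 1, q) = (lift \<omega> (primal_face (p + 1, q)) = dual_lift \<omega> (dual_face (p + 1, q)))) =
    (\<omega> (p, q) = (lift \<omega> (primal_face (p, q)) = dual_lift \<omega> (dual_face (p, q))))"
  proof (cases "even p")
    case True
    then obtain i where p: "p = 2 * i" by blast
    define j where "j = q div 2"
    have "q = 2 * j \<or> q = 2 * j + 1" unfolding j_def by presburger
    then have "vwall \<omega> p (2 * j) \<longleftrightarrow> \<omega> (p, q) \<noteq> \<omega> (p + 1, q)"
      by (intro Omega_vwall_row assms) (simp_all add: p)
    moreover have "primal_face (p + 1, q) = primal_face (p, q)" by (simp add: primal_face_def p)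
    moreover have "dual_face (p, q) = (i - 1, j - 1)" "dual_face (p + 1, q) = (i, j - 1)"
      unfolding dual_face_def p j_def fst_conv snd_conv prod.inject by presburger+
    moreover have "dual_lift \<omega> (i - 1, j - 1) \<noteq> dual_lift \<omega> (i, j - 1) \<longleftrightarrow> vwall \<omega> p (2 * j)"
      using dual_lift_step(1)[OF assms, of "i - 1" "j - 1"] by (simp add: p)
    ultimately show ?thesis by auto
  next
    case False
    then obtain i where p: "p = 2 * i + 1" by (blast elim: oddE)
    define j where "j = (q - 1) div 2"
    have "q = 2 * j + 1 \<or> q = 2 * j + 1 + 1" unfolding j_def by presburger
    then have "vwall \<omega> p (2 * j + 1) \<longleftrightarrow> \<omega> (p, q) \<noteq> \<omega> (p + 1, q)"
      by (intro Omega_vwall_row assms) (simp_all add: p)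
    moreover have "dual_face (p + 1, q) = dual_face (p, q)" by (simp add: dual_face_def p)
    moreover have "primal_face (p, q) = (i, j)" "primal_face (p + 1, q) = (i + 1, j)"
      unfolding primal_face_def p j_def fst_conv snd_conv prod.inject by presburger+
    moreover have "lift \<omega> (i, j) \<noteq> lift \<omega> (i + 1, j) \<longleftrightarrow> vwall \<omega> p (2 * j + 1)"
      using lift_step(1)[OF assms, of i j] by (simp add: p)
    ultimately show ?thesis by auto
  qed
next
  fix p q :: int
  show "(\<omega> (p, q + 1) = (lift \<omega> (primal_face (p, q + 1)) = dual_lift \<omega> (dual_face (p, q + 1)))) =
    (\<omega> (p, q) = (lift \<omega> (primal_face (p, q)) = dual_lift \<omega> (dual_face (p, q))))"
  proof (cases "even q")
    case True
    then obtain j where q: "q = 2 * j" by blast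
    define i where "i = p div 2"
    have "p = 2 * i \<or> p = 2 * i + 1" unfolding i_def by presburger
    then have "hwall \<omega> (2 * i) q \<longleftrightarrow> \<omega> (p, q) \<noteq> \<omega> (p, q + 1)"
      by (intro Omega_hwall_column assms) (simp_all add: q)
    moreover have "dual_face (p, q + 1) = dual_face (p, q)"
      unfolding dual_face_def q fst_conv snd_conv prod.inject by presburger
    moreover have "primal_face (p, q) = (i, j - 1)" "primal_face (p, q + 1) = (i, j)"
      unfolding primal_face_def q i_def fst_conv snd_conv prod.inject by presburger+
    moreover have "lift \<omega> (i, j - 1) \<noteq> lift \<omega> (i, j) \<longleftrightarrow> hwall \<omega> (2 * i) q"
      using lift_step(2)[OF assms, of i "j - 1"] by (simp add: q)
    ultimately show ?thesis by auto
  next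
    case False
    then obtain j where q: "q = 2 * j + 1" by (blast elim: oddE)
    define i where "i = (p - 1) div 2"
    have "p = 2 * i + 1 \<or> p = 2 * i + 1 + 1" unfolding i_def by presburger
    then have "hwall \<omega> (2 * i + 1) q \<longleftrightarrow> \<omega> (p, q) \<noteq> \<omega> (p, q + 1)"
      by (intro Omega_hwall_column assms) (simp_all add: q)
    moreover have "primal_face (p, q + 1) = primal_face (p, q)"
      unfolding primal_face_def q fst_conv snd_conv prod.inject by presburger
    moreover have "dual_face (p, q) = (i, j - 1)" "dual_face (p, q + 1) = (i, j)"
      unfolding dual_face_def q i_def fst_conv snd_conv prod.inject by presburger+
    moreover have "dual_lift \<omega> (i, j - 1) \<noteq> dual_lift \<omega> (i, j) \<longleftrightarrow> hwall \<omega> (2 * i + 1) q"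
      using dual_lift_step(2)[OF assms, of i "j - 1"] by (simp add: q algebra_simps)
    ultimately show ?thesis by auto
  qed
qed

definition flip_on :: "site set \<Rightarrow> config \<Rightarrow> config" where
  "flip_on F s = (\<lambda>x. if x \<in> F then \<not> s x else s x)"

text \<open>Reversing one spin changes precisely the four sides of its face. The second alternative
  is due to the face at which \<open>lift_of\<close> is normalised.\<close>

lemma lift_of_flip_face:
  assumes "is_pot (\<lambda>(i, j). \<psi> (hedge i j)) (\<lambda>(i, j). \<psi> (vedge i j)) (lift_of \<psi>)"
  shows "lift_of (flip_face (L1_face_sides (2 * i) (2 * j)) \<psi>) = flip_on {(i, j)} (lift_of \<psi>) \<or>
    lift_of (flip_face (L1_face_sides (2 * i) (2 * j)) \<psi>) = flip (flip_on {(i, j)} (lift_of \<psi>))"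
proof -
  let ?S = "L1_face_sides (2 * i) (2 * j)"
  let ?\<psi> = "flip_face ?S \<psi>"
  note S = L1_face_sides_edges[of i j]
  have h: "hedge i' j' \<in> ?S \<longleftrightarrow> j' = j \<and> (i' = i \<or> i' + 1 = i)" for i' j'
    unfolding S using hedge_neq_vedge by (auto simp: hedge_eq_iff)
  have v: "vedge i' j' \<in> ?S \<longleftrightarrow> i' = i \<and> (j' = j \<or> j' + 1 = j)" for i' j'
    unfolding S using hedge_neq_vedge[symmetric] by (auto simp: vedge_eq_iff)
  have st: "\<psi> (hedge i' j') = (lift_of \<psi> (i', j') \<noteq> lift_of \<psi> (i' + 1, j'))"
    "\<psi> (vedge i' j') = (lift_of \<psi> (i', j') \<noteq> lift_of \<psi> (i', j' + 1))" for i' j'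
    using assms unfolding is_pot_def by auto
  have pot: "is_pot (\<lambda>(i, j). ?\<psi> (hedge i j)) (\<lambda>(i, j). ?\<psi> (vedge i j)) (flip_on {(i, j)} (lift_of \<psi>))"
    unfolding is_pot_def flip_face_def flip_on_def by (auto simp: h v st)
  have "closed_form (\<lambda>(i, j). ?\<psi> (hedge i j)) (\<lambda>(i, j). ?\<psi> (vedge i j))"
    using pot by (rule is_pot_closed)
  then have "is_pot (\<lambda>(i, j). ?\<psi> (hedge i j)) (\<lambda>(i, j). ?\<psi> (vedge i j)) (lift_of ?\<psi>)"
    unfolding lift_of_def by (rule is_pot_potential)
  from is_pot_unique[OF pot this] show ?thesis .
qed

section \<open>From edges of G to clusters of faces\<close>

lemma crosses_hedge:
  assumes "q = 2 * j + 1 \<or> q = 2 * j + 2"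
  shows "crosses {(2 * i + 1, q), (2 * i + 2, q)} (hedge i j)"
proof -
  let ?x = "(real_of_int (2 * i) + 3 / 2, real_of_int q)"
  have "?x \<in> closed_segment (pt (2 * i + 1, q)) (pt (2 * i + 2, q))"
    unfolding in_segment by (intro exI[of _ "1/2"]) (simp add: pt_def field_simps)
  \<comment> \<open>The edge has length 2 and starts at height \<open>2 * j + 1/2\<close>, whence
    the parameter for height \<open>q\<close>.\<close>
  moreover have "?x \<in> closed_segment (l1v (2 * i + 2) (2 * j)) (l1v (2 * i + 2) (2 * j + 2))"
    unfolding in_segment
    by (intro exI[of _ "(real_of_int q - 2 * real_of_int j - 1 / 2) / 2"])
      (use assms in \<open>auto simp: l1v_def field_simps\<close>)
  ultimately show ?thesis
    unfolding crosses_def hedge_def by (auto simp: segment_convex_hull)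
qed

lemma crosses_vedge:
  assumes "p = 2 * i \<or> p = 2 * i + 1"
  shows "crosses {(p, 2 * j + 2), (p, 2 * j + 3)} (vedge i j)"
proof -
  let ?x = "(real_of_int p, real_of_int (2 * j) + 5 / 2)"
  have "?x \<in> closed_segment (pt (p, 2 * j + 2)) (pt (p, 2 * j + 3))"
    unfolding in_segment by (intro exI[of _ "1/2"]) (simp add: pt_def field_simps)
  moreover have "?x \<in> closed_segment (l1v (2 * i) (2 * j + 2)) (l1v (2 * i + 2) (2 * j + 2))"
    unfolding in_segment
    by (intro exI[of _ "(real_of_int p - 2 * real_of_int i + 1 / 2) / 2"])
      (use assms in \<open>auto simp: l1v_def field_simps\<close>)
  ultimately show ?thesis
    unfolding crosses_def vedge_def by (auto simp: segment_convex_hull)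
qed

text \<open>This inclusion is what finiteness requires: components of \<open>G\<close> minus the
  contours project into spin clusters.\<close>

lemma Gminus_adj_faces:
  assumes "\<omega> \<in> Omega" "Gminus_adj \<omega> u v"
  shows "primal_face u = primal_face v \<or>
    nb (primal_face u) (primal_face v) \<and> lift \<omega> (primal_face u) = lift \<omega> (primal_face v)"
proof -
  have *: "primal_face (p, q) = primal_face (p + 1, q) \<or> nb (primal_face (p, q)) (primal_face (p + 1, q)) \<and>
      lift \<omega> (primal_face (p, q)) = lift \<omega> (primal_face (p + 1, q))"
    if "Gminus_adj \<omega> (p, q) (p + 1, q)" for p q
  proof (cases "even p")
    case True
    then show ?thesis by (auto simp: primal_face_def)
  next
    case False
    then obtain i where p: "p = 2 * i + 1" by (blast elim: oddE)
    define j where "j = (q - 1) div 2"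
    have q: "q = 2 * j + 1 \<or> q = 2 * j + 2" unfolding j_def by presburger
    have f: "primal_face (p, q) = (i, j)" "primal_face (p + 1, q) = (i + 1, j)"
      unfolding primal_face_def p j_def fst_conv snd_conv prod.inject by presburger+
    have "\<not> phi1 \<omega> (hedge i j)"
      using that crosses_hedge[OF q, of i] hedge_in unfolding Gminus_adj_def p by (auto simp: add.commute)
    then show ?thesis
      using lift_step(1)[OF assms(1), of i j] unfolding f phi1_hedge by (simp add: nb_def)
  qed
  have **: "primal_face (p, q) = primal_face (p, q + 1) \<or> nb (primal_face (p, q)) (primal_face (p, q + 1)) \<and>
      lift \<omega> (primal_face (p, q)) = lift \<omega> (primal_face (p, q + 1))"
    if "Gminus_adj \<omega> (p, q) (p, q + 1)" for p q
  proof (cases "even q")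
    case False
    then obtain j where "q = 2 * j + 1" by (blast elim: oddE)
    then have "primal_face (p, q) = primal_face (p, q + 1)"
      unfolding primal_face_def fst_conv snd_conv prod.inject by presburger
    then show ?thesis by simp
  next
    case True
    then obtain j' where "q = 2 * j'" by blast
    then obtain j where q: "q = 2 * j + 2" by (metis add_diff_cancel_right' distrib_left diff_add_cancel mult.right_neutral)
    define i where "i = p div 2"
    have p: "p = 2 * i \<or> p = 2 * i + 1" unfolding i_def by presburger
    have f: "primal_face (p, q) = (i, j)" "primal_face (p, q + 1) = (i, j + 1)"
      unfolding primal_face_def q i_def fst_conv snd_conv prod.inject by presburger+
    have "\<not> phi1 \<omega> (vedge i j)"
      using that crosses_vedge[OF p, of j] vedge_in unfolding Gminus_adj_def q by (auto simp: add.commute)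
    then show ?thesis
      using lift_step(2)[OF assms(1), of i j] unfolding f phi1_vedge by (simp add: nb_def)
  qed
  have sym: "Gminus_adj \<omega> v u" using assms(2) unfolding Gminus_adj_def by (simp add: insert_commute)
  obtain a b c d where "{u, v} = {(a, b), (c, d)}" "\<bar>a - c\<bar> + \<bar>b - d\<bar> = 1"
    using assms(2) unfolding Gminus_adj_def G_edges_def by blast
  then have "nb u v" unfolding doubleton_eq_iff by (auto simp: nb_def)
  then show ?thesis
  proof (cases rule: nb_cases)
    case (1 i j) then show ?thesis using *[of i j] assms(2) by simp
  next
    case (2 i j) then show ?thesis using *[of i j] sym nb_sym[of "primal_face (i, j)" "primal_face (i + 1, j)"] by auto
  next
    case (3 i j) then show ?thesis using **[of i j] assms(2) by simp
  next
    case (4 i j) then show ?thesis using **[of i j] sym nb_sym[of "primal_face (i, j)" "primal_face (i, j + 1)"] by auto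
  qed
qed

lemma finite_component:
  assumes \<omega>: "\<omega> \<in> Omega" and fin: "\<And>a. inf_sites (sites (lift \<omega>) a) = {}"
  shows "finite (component \<omega> v)"
proof -
  define X where "X = sites (lift \<omega>) (lift \<omega> (primal_face v))"
  define C where "C = {f. conn X (primal_face v) f}"
  have vX: "primal_face v \<in> X" by (simp add: X_def sites_def)
  then have "finite C" using fin[of "lift \<omega> (primal_face v)"] unfolding C_def X_def inf_sites_def by blast
  have reach: "conn X (primal_face v) (primal_face w)" if "(Gminus_adj \<omega>)\<^sup>*\<^sup>* v w" for w
    using that
  proof (induction rule: rtranclp_induct)
    case (step y z)
    have yX: "primal_face y \<in> X" using conn_in[OF step.IH vX] .
    have "conn X (primal_face y) (primal_face z)"
      using Gminus_adj_faces[OF \<omega> step.hyps(2)]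
    proof
      assume "nb (primal_face y) (primal_face z) \<and> lift \<omega> (primal_face y) = lift \<omega> (primal_face z)"
      then show ?thesis using yX by (intro conn_edge) (auto simp: X_def sites_def)
    qed simp
    with step.IH show ?case by (rule conn_trans)
  qed simp
  \<comment> \<open>A face has four vertices, all in the box of radius 1 around its lower-left
    vertex, so finitely many faces hold finitely many vertices.\<close>
  have "w \<in> sqbox (2 * fst (primal_face w), 2 * snd (primal_face w) + 1) 1" for w
    unfolding sqbox_def primal_face_def mem_Collect_eq fst_conv snd_conv by presburger
  then have "component \<omega> v \<subseteq> (\<Union>f\<in>C. sqbox (2 * fst f, 2 * snd f + 1) 1)"
    using reach unfolding component_def C_def by blast
  then show ?thesis by (rule finite_subset) (use \<open>finite C\<close> in auto)
qed

section \<open>Measurability of the spin fields\<close>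

lemma pred_pot1:
  assumes "\<And>k. Measurable.pred M (\<lambda>w. d w k)"
  shows "Measurable.pred M (\<lambda>w. pot1 (d w) i)"
proof (induction i rule: int_induct[where k = 0])
  case (step1 i)
  then show ?case using assms by (simp add: pot1_step)
next
  case (step2 i)
  have "pot1 (d w) (i - 1) = (pot1 (d w) i \<noteq> d w (i - 1))" for w
    using pot1_step[of "d w" "i - 1"] by auto
  then show ?case using step2 assms by simp
qed simp

lemma pred_potential:
  assumes "\<And>x. Measurable.pred M (\<lambda>w. h w x)" "\<And>x. Measurable.pred M (\<lambda>w. v w x)"
  shows "Measurable.pred M (\<lambda>w. potential (h w) (v w) x)"
proof -
  obtain i j where x: "x = (i, j)" by (cases x)
  have "Measurable.pred M (\<lambda>w. pot1 (\<lambda>k. h w (k, 0)) i)" "Measurable.pred M (\<lambda>w. pot1 (\<lambda>k. v w (i, k)) j)"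
    by (intro pred_pot1 assms)+
  then show ?thesis by (simp add: potential_def x)
qed

lemma pred_compose:
  assumes "Measurable.pred cfg_space Q" "\<And>v. Measurable.pred M (\<lambda>w. s w v)"
  shows "Measurable.pred M (\<lambda>w. Q (s w))"
proof -
  have "(\<lambda>w. s w) \<in> measurable M cfg_space"
    unfolding cfg_space_def using assms(2) by (intro measurable_PiM_single') (auto simp: space_PiM)
  from measurable_compose[OF this assms(1)] show ?thesis by simp
qed

lemma pred_coordinate: "Measurable.pred cfg_space (\<lambda>s. s v)"
  unfolding cfg_space_def by measurable

lemma pred_flip_coord:
  "(\<And>v. Measurable.pred M (\<lambda>w. s w v)) \<Longrightarrow> Measurable.pred M (\<lambda>w. flip (s w) v)"
  by (simp add: flip_def)

lemma pred_flip_on_coord: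
  "(\<And>v. Measurable.pred M (\<lambda>w. s w v)) \<Longrightarrow> Measurable.pred M (\<lambda>w. flip_on F (s w) v)"
  by (cases "v \<in> F") (simp_all add: flip_on_def)

lemma pred_sites:
  "(\<And>v. Measurable.pred M (\<lambda>w. s w v)) \<Longrightarrow> Measurable.pred M (\<lambda>w. v \<in> sites (s w) a)"
  by (simp add: sites_def)

lemma pred_lift:
  assumes "\<And>v. Measurable.pred M (\<lambda>w. s w v)"
  shows "Measurable.pred M (\<lambda>w. lift (s w) v)"
proof -
  note [measurable] = assms
  show ?thesis
    unfolding lift_def
    by (rule pred_potential) (simp_all add: vwall_def hwall_def split_beta)
qed

lemma flip_on_flip_on [simp]: "flip_on F (flip_on F s) = s"
  by (simp add: flip_on_def fun_eq_iff)

lemma flip_on_flip: "flip_on F (flip s) = flip (flip_on F s)"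
  by (simp add: flip_on_def flip_def fun_eq_iff)

section \<open>Zero-one law and sign symmetry\<close>

locale constrained_percolation = prob_space \<mu> for \<mu> :: "config measure" +
  assumes sets_mu: "sets \<mu> = sets cfg_space"
    and on_Omega: "AE \<omega> in \<mu>. \<omega> \<in> Omega"
    and A1: "\<And>a b. even (a + b) \<Longrightarrow> distr \<mu> \<mu> (shift (a, b)) = \<mu>"
    and A2: "\<And>E. E \<in> sets \<mu> \<Longrightarrow> (\<forall>a b. shift (2*a, 2*b) -` E = E) \<Longrightarrow>
               measure \<mu> E = 0 \<or> measure \<mu> E = 1"
    and A3: "distr \<mu> \<mu> flip = \<mu>"
    and A4: "\<And>S E. S \<in> L1_faces \<Longrightarrow> E \<in> sets L1_cfg_space \<Longrightarrow>
               measure (distr \<mu> L1_cfg_space phi1_cfg) E > 0 \<Longrightarrow>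
               measure (distr \<mu> L1_cfg_space phi1_cfg) (flip_face S ` E) > 0"
begin

lemma space_mu [simp]: "space \<mu> = UNIV"
proof -
  have "space cfg_space = UNIV" by (simp add: cfg_space_def space_PiM)
  then show ?thesis using sets_eq_imp_space_eq[OF sets_mu] by simp
qed

lemma measurable_to_mu: "measurable M \<mu> = measurable M cfg_space"
  by (rule measurable_cong_sets) (simp_all add: sets_mu)

lemma measurable_from_mu: "measurable \<mu> M = measurable cfg_space M"
  by (rule measurable_cong_sets) (simp_all add: sets_mu)

lemma pred_coord [measurable]: "Measurable.pred \<mu> (\<lambda>\<omega>. \<omega> v)"
  unfolding measurable_from_mu by (rule pred_coordinate)

lemma measurable_into_mu:
  assumes "\<And>v. Measurable.pred \<mu> (\<lambda>\<omega>. f \<omega> v)"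
  shows "f \<in> measurable \<mu> \<mu>"
  unfolding measurable_to_mu cfg_space_def using assms
  by (intro measurable_PiM_single') (auto simp: space_PiM)

lemma shift_measurable: "shift t \<in> measurable \<mu> \<mu>"
  by (rule measurable_into_mu) (simp add: shift_apply)

lemma flip_measurable: "flip \<in> measurable \<mu> \<mu>"
  by (rule measurable_into_mu) (simp add: flip_def)

lemma Omega_pred [measurable]: "Measurable.pred \<mu> (\<lambda>\<omega>. \<omega> \<in> Omega)"
  unfolding Omega_def allowed_def by simp

lemma lift_pred [measurable]: "Measurable.pred \<mu> (\<lambda>\<omega>. lift \<omega> v)"
  by (rule pred_lift) simp

lemma dual_lift_pred [measurable]: "Measurable.pred \<mu> (\<lambda>\<omega>. dual_lift \<omega> v)"
  unfolding dual_lift_def by (rule pred_lift) (simp add: shift_apply)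

lemma AE_shift:
  assumes "even (a + b)" "Measurable.pred \<mu> P"
  shows "(AE \<omega> in \<mu>. P (shift (a, b) \<omega>)) \<longleftrightarrow> (AE \<omega> in \<mu>. P \<omega>)"
proof -
  have "(AE \<omega> in distr \<mu> \<mu> (shift (a, b)). P \<omega>) \<longleftrightarrow> (AE \<omega> in \<mu>. P (shift (a, b) \<omega>))"
    using assms(2) by (intro AE_distr_iff shift_measurable) (simp add: pred_def)
  then show ?thesis unfolding A1[OF assms(1)] by (rule sym)
qed

text \<open>The translation (1,1) exchanges the two lattices and preserves the law by
  \<open>A1\<close>.\<close>

lemma AE_dual_lift:
  assumes "Measurable.pred cfg_space Q"
  shows "(AE \<omega> in \<mu>. Q (dual_lift \<omega>)) \<longleftrightarrow> (AE \<omega> in \<mu>. Q (lift \<omega>))"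
  unfolding dual_lift_def by (rule AE_shift) (auto intro: pred_compose[OF assms])

text \<open>Invariance under negation frees \<open>Q (lift \<omega>)\<close> from the normalisation;
  without it translation invariance of \<open>Q\<close> would not pass to the event.\<close>

definition invariant :: "(config \<Rightarrow> bool) \<Rightarrow> bool" where
  "invariant Q \<longleftrightarrow> (\<forall>s. Q (flip s) = Q s) \<and> (\<forall>t s. Q (shift t s) = Q s)"

lemma AE_not_0: "measure \<mu> E = 0 \<Longrightarrow> E \<in> sets \<mu> \<Longrightarrow> AE \<omega> in \<mu>. \<omega> \<notin> E"
  using prob_eq_0 by blast

lemma AE_in_1: "measure \<mu> E = 1 \<Longrightarrow> E \<in> sets \<mu> \<Longrightarrow> AE \<omega> in \<mu>. \<omega> \<in> E"
  using AE_in_set_eq_1 by blast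

lemma zero_one:
  assumes Q: "Measurable.pred cfg_space Q" and inv: "invariant Q"
  shows "(AE \<omega> in \<mu>. Q (lift \<omega>)) \<or> (AE \<omega> in \<mu>. \<not> Q (lift \<omega>))"
proof -
  have [measurable]: "Measurable.pred \<mu> (\<lambda>\<omega>. Q (lift \<omega>))"
    by (rule pred_compose[OF Q]) simp
  \<comment> \<open>\<open>lift_shift\<close> holds on \<open>Omega\<close> only, while
    \<open>A2\<close> asks for exact invariance of the event; intersecting with \<open>Omega\<close>
    supplies it.\<close>
  define E where "E = {\<omega> \<in> space \<mu>. \<omega> \<in> Omega \<and> Q (lift \<omega>)}"
  have E: "E \<in> sets \<mu>" unfolding E_def by measurable
  have "shift (2*a, 2*b) -` E = E" for a b
    using lift_shift[of _ a b] inv Omega_shift[of "2*a" "2*b"]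
    unfolding E_def invariant_def by (auto; metis)
  then have "measure \<mu> E = 0 \<or> measure \<mu> E = 1" by (intro A2 E) simp
  then show ?thesis
  proof
    assume "measure \<mu> E = 0"
    from AE_not_0[OF this E] on_Omega have "AE \<omega> in \<mu>. \<not> Q (lift \<omega>)"
      by eventually_elim (simp add: E_def)
    then show ?thesis ..
  next
    assume "measure \<mu> E = 1"
    from AE_in_1[OF this E] have "AE \<omega> in \<mu>. Q (lift \<omega>)"
      by eventually_elim (simp add: E_def)
    then show ?thesis ..
  qed
qed

text \<open>The event that \<open>R\<close> holds for the pair of lifts whose exclusive or is \<open>\<omega>\<close> is invariant, hence
  trivial, and \<open>flip\<close> maps it to a disjoint event of the same probability.\<close>

lemma odd_null:
  assumes mR: "\<And>s t. (\<And>v. Measurable.pred \<mu> (\<lambda>\<omega>. s \<omega> v)) \<Longrightarrow> (\<And>v. Measurable.pred \<mu> (\<lambda>\<omega>. t \<omega> v)) \<Longrightarrow>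
      Measurable.pred \<mu> (\<lambda>\<omega>. R (s \<omega>) (t \<omega>))"
    and shift: "\<And>x s t. R (shift x s) (shift x t) = R s t"
    and both: "\<And>s t. R (flip s) (flip t) = R s t"
    and odd: "\<And>s t. R s t \<Longrightarrow> \<not> R (flip s) t"
  shows "AE \<omega> in \<mu>. \<not> R (lift \<omega>) (dual_lift \<omega>) \<and> \<not> R (flip (lift \<omega>)) (dual_lift \<omega>)"
proof -
  \<comment> \<open>On \<open>Omega\<close> exactly two signed pairs reproduce
    \<open>\<omega>\<close>, and they differ by joint negation, to which \<open>R\<close> is
    blind.\<close>
  define rep where "rep \<omega> s t \<longleftrightarrow> (s = lift \<omega> \<or> s = flip (lift \<omega>)) \<and> (t = dual_lift \<omega> \<or> t = flip (dual_lift \<omega>)) \<and>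
    (\<forall>v. \<omega> v = (s (primal_face v) = t (dual_face v)))" for \<omega> s t
  have rep_ex: "rep \<omega> (lift \<omega>) (if offset \<omega> then dual_lift \<omega> else flip (dual_lift \<omega>))" if "\<omega> \<in> Omega" for \<omega>
    using lift_decomposition[OF that] unfolding rep_def by (auto simp: flip_def)
  have rep_uniq: "(s' = s \<and> t' = t) \<or> (s' = flip s \<and> t' = flip t)" if "rep \<omega> s t" "rep \<omega> s' t'" for \<omega> s t s' t'
  proof -
    have "\<omega> 0 = (s (primal_face 0) = t (dual_face 0))" "\<omega> 0 = (s' (primal_face 0) = t' (dual_face 0))"
      using that unfolding rep_def by blast+
    moreover have "s' = s \<or> s' = flip s" "t' = t \<or> t' = flip t"
      using that unfolding rep_def by auto
    ultimately show ?thesis by (auto simp: flip_def)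
  qed
  have rep_shift: "rep (shift (2*a, 2*b) \<omega>) (shift (a, b) s) (shift (a, b) t)" if "rep \<omega> s t" "\<omega> \<in> Omega" for a b \<omega> s t
  proof -
    have 1: "lift (shift (2*a, 2*b) \<omega>) = shift (a, b) (lift \<omega>) \<or>
        lift (shift (2*a, 2*b) \<omega>) = flip (shift (a, b) (lift \<omega>))" by (rule lift_shift[OF that(2)])
    have "shift (1, 1) \<omega> \<in> Omega" using that(2) Omega_shift[of 1 1] by simp
    from lift_shift[OF this, of a b]
    have 2: "dual_lift (shift (2*a, 2*b) \<omega>) = shift (a, b) (dual_lift \<omega>) \<or>
        dual_lift (shift (2*a, 2*b) \<omega>) = flip (shift (a, b) (dual_lift \<omega>))"
      unfolding dual_lift_def shift_shift by (simp add: add.commute)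
    have 3: "primal_face (v + (2*a, 2*b)) = primal_face v + (a, b)" "dual_face (v + (2*a, 2*b)) = dual_face v + (a, b)" for v
      by (cases v; simp add: primal_face_def dual_face_def; presburger)+
    show ?thesis
      using that(1) 1 2 unfolding rep_def by (auto simp: shift_flip shift_apply 3)
  qed
  \<comment> \<open>The walls, and so both lifts, do not notice a global flip; it is absorbed by
    negating one field in the decomposition.\<close>
  have rep_flip: "rep (flip \<omega>) (flip s) t" if "rep \<omega> s t" for \<omega> s t
    using that unfolding rep_def dual_lift_def shift_flip lift_flip by (auto simp: flip_def)
  define E where "E = {\<omega> \<in> space \<mu>. \<omega> \<in> Omega \<and> (\<exists>s t. rep \<omega> s t \<and> R s t)}"
  have E_iff: "\<omega> \<in> E \<longleftrightarrow> R s t" if "rep \<omega> s t" "\<omega> \<in> Omega" for \<omega> s t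
    using that rep_uniq[OF that(1)] both unfolding E_def by auto
  have [measurable]: "Measurable.pred \<mu> (\<lambda>\<omega>. R (lift \<omega>) (dual_lift \<omega>))"
    "Measurable.pred \<mu> (\<lambda>\<omega>. R (lift \<omega>) (flip (dual_lift \<omega>)))"
    by (rule mR; simp add: flip_def)+
  have [measurable]: "Measurable.pred \<mu> offset"
    unfolding offset_def by simp
  have "E = {\<omega> \<in> space \<mu>. \<omega> \<in> Omega \<and> (if offset \<omega> then R (lift \<omega>) (dual_lift \<omega>) else R (lift \<omega>) (flip (dual_lift \<omega>)))}"
    (is "_ = ?E")
  proof (intro set_eqI)
    fix \<omega>
    show "\<omega> \<in> E \<longleftrightarrow> \<omega> \<in> ?E"
    proof (cases "\<omega> \<in> Omega")
      case True
      then show ?thesis using E_iff[OF rep_ex[OF True] True] by simp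
    qed (simp add: E_def)
  qed
  also have "\<dots> \<in> sets \<mu>" by measurable
  finally have E: "E \<in> sets \<mu>" .
  have "shift (2*a, 2*b) -` E = E" for a b
  proof (intro set_eqI)
    fix \<omega>
    have O: "shift (2*a, 2*b) \<omega> \<in> Omega \<longleftrightarrow> \<omega> \<in> Omega" by (rule Omega_shift) simp
    show "\<omega> \<in> shift (2*a, 2*b) -` E \<longleftrightarrow> \<omega> \<in> E"
    proof (cases "\<omega> \<in> Omega")
      case True
      from rep_ex[OF True] obtain s t where st: "rep \<omega> s t" by blast
      show ?thesis
        using E_iff[OF rep_shift[OF st True, of a b]] E_iff[OF st True] O True shift by simp
    qed (simp add: E_def O)
  qed
  then have 01: "measure \<mu> E = 0 \<or> measure \<mu> E = 1" by (intro A2 E) simp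
  have F: "flip -` E \<in> sets \<mu>" using measurable_sets[OF flip_measurable E] by simp
  have "measure \<mu> (flip -` E) = measure (distr \<mu> \<mu> flip) E"
    using measure_distr[OF flip_measurable E] by simp
  then have FE: "measure \<mu> (flip -` E) = measure \<mu> E" by (simp add: A3)
  have F_iff: "\<omega> \<in> flip -` E \<longleftrightarrow> R (flip s) t" if "rep \<omega> s t" "\<omega> \<in> Omega" for \<omega> s t
    using E_iff[OF rep_flip[OF that(1)]] that(2) Omega_flip by simp
  have disj: "E \<inter> flip -` E = {}"
  proof (intro equals0I)
    fix \<omega> assume w: "\<omega> \<in> E \<inter> flip -` E"
    then have O: "\<omega> \<in> Omega" by (simp add: E_def)
    from rep_ex[OF O] obtain s t where st: "rep \<omega> s t" by blast
    show False using w E_iff[OF st O] F_iff[OF st O] odd by blast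
  qed
  have "measure \<mu> E + measure \<mu> (flip -` E) = measure \<mu> (E \<union> flip -` E)"
    using finite_measure_Union[OF E F disj] by simp
  also have "\<dots> \<le> 1" by simp
  finally have z: "measure \<mu> E = 0" using 01 FE by linarith
  from AE_not_0[OF z E] AE_not_0[OF trans[OF FE z] F] on_Omega show ?thesis
  proof eventually_elim
    case (elim \<omega>)
    from rep_ex[OF elim(3)] E_iff[OF _ elim(3)] F_iff[OF _ elim(3)] elim(1,2)
    show ?case using both[of "lift \<omega>" "flip (dual_lift \<omega>)"] both[of "flip (lift \<omega>)" "flip (dual_lift \<omega>)"]
      by (auto split: if_splits)
  qed
qed

text \<open>If the asymmetry were not null, the zero-one law would make it almost sure, in both
  fields by translation. Whether the favoured signs of the two fields agree is then a relation
  excluded by \<open>odd_null\<close>, and so is their disagreement.\<close>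

lemma asymmetric_null:
  assumes M: "Measurable.pred cfg_space Q" and shift: "\<And>x s. Q (shift x s) = Q s"
    and asym: "\<And>s. Q s \<Longrightarrow> \<not> Q (flip s)"
  shows "AE \<omega> in \<mu>. \<not> Q (lift \<omega>) \<and> \<not> Q (flip (lift \<omega>))"
proof -
  have mQ: "Measurable.pred \<mu> (\<lambda>\<omega>. Q (s \<omega>))" if "\<And>v. Measurable.pred \<mu> (\<lambda>\<omega>. s \<omega> v)" for s
    using M that by (rule pred_compose)
  have mflip: "Measurable.pred cfg_space (\<lambda>s. Q (flip s))"
    by (rule pred_compose[OF M]) (rule pred_flip_coord[OF pred_coordinate])
  let ?S = "\<lambda>s. Q s \<or> Q (flip s)"
  have mS: "Measurable.pred cfg_space ?S" using M mflip by simp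
  have inv: "invariant ?S" unfolding invariant_def by (auto simp: shift shift_flip[symmetric])
  have null: "AE \<omega> in \<mu>. \<not> ((Q (lift \<omega>) \<and> Q (dual_lift \<omega>)) \<or> (Q (flip (lift \<omega>)) \<and> Q (flip (dual_lift \<omega>)))) \<and>
      \<not> ((Q (flip (lift \<omega>)) \<and> Q (dual_lift \<omega>)) \<or> (Q (flip (flip (lift \<omega>))) \<and> Q (flip (dual_lift \<omega>))))"
  proof (rule odd_null[where R = "\<lambda>s t. (Q s \<and> Q t) \<or> (Q (flip s) \<and> Q (flip t))"])
    fix s t :: "config \<Rightarrow> config"
    assume s: "\<And>v. Measurable.pred \<mu> (\<lambda>\<omega>. s \<omega> v)" and t: "\<And>v. Measurable.pred \<mu> (\<lambda>\<omega>. t \<omega> v)"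
    note [measurable] = mQ[OF s] mQ[OF t] mQ[OF pred_flip_coord[OF s]] mQ[OF pred_flip_coord[OF t]]
    show "Measurable.pred \<mu> (\<lambda>\<omega>. (Q (s \<omega>) \<and> Q (t \<omega>)) \<or> (Q (flip (s \<omega>)) \<and> Q (flip (t \<omega>))))" by simp
  qed (use asym in \<open>auto simp: shift shift_flip[symmetric]\<close>)
  have "\<not> (AE \<omega> in \<mu>. ?S (lift \<omega>))"
  proof
    assume a: "AE \<omega> in \<mu>. ?S (lift \<omega>)"
    then have "AE \<omega> in \<mu>. ?S (dual_lift \<omega>)" using AE_dual_lift[OF mS] by blast
    with a null have "AE \<omega> in \<mu>. False" by eventually_elim auto
    then show False by simp
  qed
  then have "AE \<omega> in \<mu>. \<not> ?S (lift \<omega>)" using zero_one[OF mS inv] by blast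
  then show ?thesis by eventually_elim auto
qed


section \<open>Finite energy\<close>

lemma phi1_cfg_measurable: "phi1_cfg \<in> measurable \<mu> L1_cfg_space"
proof -
  have "Measurable.pred \<mu> (\<lambda>\<omega>. phi1 \<omega> e)" if "e \<in> L1_edges" for e
    using that
  proof (cases rule: L1_edges_cases)
    case (1 i j)
    show ?thesis unfolding 1 phi1_hedge vwall_def by simp
  next
    case (2 i j)
    show ?thesis unfolding 2 phi1_vedge hwall_def by simp
  qed
  then show ?thesis unfolding phi1_cfg_def[abs_def] L1_cfg_space_def by (intro measurable_restrict)
qed

lemma L1_pred_coord: "e \<in> L1_edges \<Longrightarrow> Measurable.pred L1_cfg_space (\<lambda>\<psi>. \<psi> e)"
  unfolding L1_cfg_space_def by (rule measurable_component_singleton)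

lemma lift_of_pred [measurable]: "Measurable.pred L1_cfg_space (\<lambda>\<psi>. lift_of \<psi> v)"
proof -
  note [measurable] = L1_pred_coord[OF hedge_in] L1_pred_coord[OF vedge_in]
  show ?thesis unfolding lift_of_def by (rule pred_potential) (simp_all add: split_beta)
qed

text \<open>An event has positive probability iff its negation does not hold almost surely; this
  phrasing keeps the finite-energy lemmas free of measurability side conditions.\<close>

lemma finite_energy_site:
  assumes Q: "Measurable.pred cfg_space Q" and flip: "\<And>s. Q (flip s) = Q s"
    and pos: "\<not> (AE \<omega> in \<mu>. \<not> Q (lift \<omega>))"
  shows "\<not> (AE \<omega> in \<mu>. \<not> Q (flip_on {x} (lift \<omega>)))"
proof
  assume null: "AE \<omega> in \<mu>. \<not> Q (flip_on {x} (lift \<omega>))"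
  obtain i j where x: "x = (i, j)" by (cases x)
  define S where "S = L1_face_sides (2 * i) (2 * j)"
  have "even (2 * i)" "even (2 * j)" by simp_all
  then have S: "S \<in> L1_faces" unfolding S_def L1_faces_def by blast
  \<comment> \<open>For closed \<open>\<psi>\<close> flipping a face amounts to flipping one spin;
    almost every \<open>phi1_cfg \<omega>\<close> is closed, so the restriction loses no
    probability.\<close>
  define cl where "cl \<psi> = is_pot (\<lambda>(i, j). \<psi> (hedge i j)) (\<lambda>(i, j). \<psi> (vedge i j)) (lift_of \<psi>)" for \<psi>
  note [measurable] = L1_pred_coord[OF hedge_in] L1_pred_coord[OF vedge_in]
  have [measurable]: "Measurable.pred L1_cfg_space cl"
    unfolding cl_def is_pot_def by simp
  have [measurable]: "Measurable.pred L1_cfg_space (\<lambda>\<psi>. Q (lift_of \<psi>))"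
    by (rule pred_compose[OF Q, where s = lift_of]) (rule lift_of_pred)
  have [measurable]: "Measurable.pred L1_cfg_space (\<lambda>\<psi>. Q (flip_on {x} (lift_of \<psi>)))"
    by (rule pred_compose[OF Q, where s = "\<lambda>\<psi>. flip_on {x} (lift_of \<psi>)"])
      (rule pred_flip_on_coord[where s = lift_of, OF lift_of_pred])
  have [measurable]: "Measurable.pred \<mu> (\<lambda>\<omega>. Q (lift \<omega>))" by (rule pred_compose[OF Q, where s = lift]) simp
  define E where "E = {\<psi> \<in> space L1_cfg_space. cl \<psi> \<and> Q (lift_of \<psi>)}"
  \<comment> \<open>A measurable set containing the image of \<open>E\<close>, so that monotonicity
    takes the place of measurability of the image.\<close>
  define F where "F = {\<psi> \<in> space L1_cfg_space. Q (flip_on {x} (lift_of \<psi>))}"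
  have E: "E \<in> sets L1_cfg_space" and F: "F \<in> sets L1_cfg_space"
    unfolding E_def F_def by measurable
  let ?\<nu> = "distr \<mu> L1_cfg_space phi1_cfg"
  have in_space: "phi1_cfg \<omega> \<in> space L1_cfg_space" for \<omega>
    using measurable_space[OF phi1_cfg_measurable] by simp
  have cl_phi: "cl (phi1_cfg \<omega>)" if "\<omega> \<in> Omega" for \<omega>
    using is_pot_lift[OF that] unfolding cl_def lift_of_phi1_cfg
    by (simp add: phi1_cfg_def hedge_in vedge_in phi1_hedge phi1_vedge)
  have E': "phi1_cfg -` E \<in> sets \<mu>" using measurable_sets[OF phi1_cfg_measurable E] by simp
  have "measure ?\<nu> E \<noteq> 0"
  proof
    assume "measure ?\<nu> E = 0"
    then have "measure \<mu> (phi1_cfg -` E) = 0" using measure_distr[OF phi1_cfg_measurable E] by simp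
    from AE_not_0[OF this E'] on_Omega have "AE \<omega> in \<mu>. \<not> Q (lift \<omega>)"
      by eventually_elim (simp add: E_def in_space cl_phi lift_of_phi1_cfg)
    then show False using pos by blast
  qed
  then have "measure ?\<nu> E > 0" by (simp add: zero_less_measure_iff)
  then have "measure ?\<nu> (flip_face S ` E) > 0" by (rule A4[OF S E])
  moreover have "flip_face S ` E \<subseteq> F"
  proof
    fix \<psi>' assume "\<psi>' \<in> flip_face S ` E"
    then obtain \<psi> where \<psi>: "\<psi> \<in> space L1_cfg_space" "cl \<psi>" "Q (lift_of \<psi>)" "\<psi>' = flip_face S \<psi>"
      unfolding E_def by blast
    have "e \<in> L1_edges" if "e \<in> S" for e
      using that hedge_in vedge_in unfolding S_def L1_face_sides_edges by auto
    then have "\<psi>' \<in> space L1_cfg_space"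
      using \<psi>(1) unfolding \<psi>(4) L1_cfg_space_def space_PiM
      by (auto simp: flip_face_def PiE_iff extensional_def)
    moreover have "Q (flip_on {x} (lift_of \<psi>'))"
      using lift_of_flip_face[OF \<psi>(2)[unfolded cl_def], of i j]
      unfolding \<psi>(4) S_def[symmetric] x[symmetric]
    proof
      assume "lift_of (flip_face S \<psi>) = flip_on {x} (lift_of \<psi>)"
      then show "Q (flip_on {x} (lift_of (flip_face S \<psi>)))" using \<psi>(3) by simp
    next
      assume "lift_of (flip_face S \<psi>) = flip (flip_on {x} (lift_of \<psi>))"
      then show "Q (flip_on {x} (lift_of (flip_face S \<psi>)))" using \<psi>(3) by (simp add: flip_on_flip flip)
    qed
    ultimately show "\<psi>' \<in> F" by (simp add: F_def)
  qed
  ultimately have "measure ?\<nu> F > 0"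
  proof -
    interpret \<nu>: prob_space ?\<nu> by (rule prob_space_distr[OF phi1_cfg_measurable])
    have "measure ?\<nu> (flip_face S ` E) \<le> measure ?\<nu> F"
      by (rule \<nu>.finite_measure_mono) (use \<open>flip_face S ` E \<subseteq> F\<close> F in auto)
    with \<open>measure ?\<nu> (flip_face S ` E) > 0\<close> show ?thesis by linarith
  qed
  then have "measure \<mu> (phi1_cfg -` F) > 0" using measure_distr[OF phi1_cfg_measurable F] by simp
  moreover have "AE \<omega> in \<mu>. \<omega> \<notin> phi1_cfg -` F"
    using null by eventually_elim (simp add: F_def lift_of_phi1_cfg)
  ultimately show False
    using measurable_sets[OF phi1_cfg_measurable F] prob_eq_0[of "phi1_cfg -` F"] by simp
qed

lemma finite_energy_set:
  assumes "finite F" "Measurable.pred cfg_space Q" "\<And>s. Q (flip s) = Q s"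
    "\<not> (AE \<omega> in \<mu>. \<not> Q (lift \<omega>))"
  shows "\<not> (AE \<omega> in \<mu>. \<not> Q (flip_on F (lift \<omega>)))"
  using assms
proof (induction F)
  case empty
  then show ?case by (simp add: flip_on_def)
next
  case (insert x F)
  have e: "flip_on (insert x F) s = flip_on F (flip_on {x} s)" for s
    using insert.hyps by (auto simp: flip_on_def fun_eq_iff)
  have "\<not> (AE \<omega> in \<mu>. \<not> Q (flip_on F (flip_on {x} (lift \<omega>))))"
  proof (rule finite_energy_site[where Q = "\<lambda>s. Q (flip_on F s)"])
    show "Measurable.pred cfg_space (\<lambda>s. Q (flip_on F s))"
      by (rule pred_compose[OF insert.prems(1), where s = "flip_on F"])
        (rule pred_flip_on_coord[where s = "\<lambda>s. s", OF pred_coordinate])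
    show "Q (flip_on F (flip s)) = Q (flip_on F s)" for s by (simp add: flip_on_flip insert.prems(2))
    show "\<not> (AE \<omega> in \<mu>. \<not> Q (flip_on F (lift \<omega>)))" using insert by blast
  qed
  then show ?case by (simp add: e)
qed

text \<open>Were \<open>Q\<close> not null, one of the countably many finite sets \<open>F\<close>
  would work with positive probability, and flipping on \<open>F\<close> would carry that event into
  \<open>W\<close>.\<close>

lemma finite_energy:
  assumes Q: "Measurable.pred cfg_space Q" "\<And>s. Q (flip s) = Q s"
    and W: "Measurable.pred cfg_space W" "\<And>s. W (flip s) = W s"
    and QW: "\<And>s. Q s \<Longrightarrow> \<exists>F. finite F \<and> W (flip_on F s)"
    and null: "AE \<omega> in \<mu>. \<not> W (lift \<omega>)"
  shows "AE \<omega> in \<mu>. \<not> Q (lift \<omega>)"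
proof -
  have "AE \<omega> in \<mu>. \<not> (Q (lift \<omega>) \<and> W (flip_on F (lift \<omega>)))" if F: "finite F" for F
  proof (rule ccontr)
    assume *: "\<not> ?thesis"
    have "\<not> (AE \<omega> in \<mu>. \<not> (Q (flip_on F (lift \<omega>)) \<and> W (flip_on F (flip_on F (lift \<omega>)))))"
    proof (rule finite_energy_set[OF F, where Q = "\<lambda>s. Q s \<and> W (flip_on F s)"])
      have "Measurable.pred cfg_space (\<lambda>s. W (flip_on F s))"
        by (rule pred_compose[OF W(1), where s = "flip_on F"])
          (rule pred_flip_on_coord[where s = "\<lambda>s. s", OF pred_coordinate])
      then show "Measurable.pred cfg_space (\<lambda>s. Q s \<and> W (flip_on F s))" using Q(1) by simp
    qed (use * Q W in \<open>auto simp: flip_on_flip\<close>)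
    moreover have "AE \<omega> in \<mu>. \<not> (Q (flip_on F (lift \<omega>)) \<and> W (flip_on F (flip_on F (lift \<omega>))))"
      using null by eventually_elim simp
    ultimately show False by blast
  qed
  moreover have "countable {F :: site set. finite F}" by (rule countable_Collect_finite)
  ultimately have "AE \<omega> in \<mu>. \<forall>F\<in>{F. finite F}. \<not> (Q (lift \<omega>) \<and> W (flip_on F (lift \<omega>)))"
    by (intro AE_ball_countable') auto
  then show ?thesis by eventually_elim (use QW in blast)
qed


section \<open>Counting infinite clusters\<close>

text \<open>A positive trifurcation probability would produce an expected number growing like the
  area of a large square, whereas the sphere around it allows only a multiple of the side
  length.\<close>

lemma no_three_infinite: "AE \<omega> in \<mu>. \<forall>a. \<not> three_inf (sites (lift \<omega>) a)"
proof -
  define Q where "Q s \<longleftrightarrow> (\<exists>a. three_inf (sites s a))" for s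
  define W where "W n s \<longleftrightarrow> (\<exists>a. trifurcation n 0 (sites s a))" for n s
  have mQ: "Measurable.pred cfg_space Q"
  proof -
    have [measurable]: "Measurable.pred cfg_space (\<lambda>s. three_inf (sites s a))" for a
      by (rule pred_three_inf[where X = "\<lambda>s. sites s a"]) (rule pred_sites[where s = "\<lambda>s. s", OF pred_coordinate])
    show ?thesis unfolding Q_def[abs_def] by simp
  qed
  have mW: "Measurable.pred cfg_space (W n)" for n
  proof -
    have [measurable]: "Measurable.pred cfg_space (\<lambda>s. trifurcation n 0 (sites s a))" for a
      by (rule pred_trifurcation[where X = "\<lambda>s. sites s a"]) (rule pred_sites[where s = "\<lambda>s. s", OF pred_coordinate])
    show ?thesis unfolding W_def[abs_def] by simp
  qed
  have ex_flip: "(\<exists>a. P (\<not> a)) \<longleftrightarrow> (\<exists>a. P a)" for P :: "bool \<Rightarrow> bool"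
    by (auto simp: ex_bool_eq)
  have fQ: "Q (flip s) = Q s" and fW: "W n (flip s) = W n s" for s n
    unfolding Q_def W_def sites_flip by (rule ex_flip)+
  have null: "AE \<omega> in \<mu>. \<not> W n (lift \<omega>)" for n
  proof (rule ccontr)
    assume pos: "\<not> ?thesis"
    define D where "D x = {\<omega> \<in> space \<mu>. \<omega> \<in> Omega \<and> (\<exists>a. trifurcation n x (sites (lift \<omega>) a))}" for x
    have D_sets: "D x \<in> sets \<mu>" for x
    proof -
      have [measurable]: "Measurable.pred \<mu> (\<lambda>\<omega>. trifurcation n x (sites (lift \<omega>) a))" for a
        by (rule pred_trifurcation[where X = "\<lambda>\<omega>. sites (lift \<omega>) a"]) (rule pred_sites[where s = lift], simp)
      show ?thesis unfolding D_def by measurable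
    qed
    have n: "n \<ge> 0"
    proof (rule ccontr)
      assume "\<not> n \<ge> 0"
      then have "sqbox 0 n = {}" by (auto simp: sqbox_def)
      then have "\<not> W n s" for s by (simp add: W_def trifurcation_def branch_ends_def)
      then show False using pos by simp
    qed
    have D0: "measure \<mu> (D 0) > 0"
    proof (rule ccontr)
      assume "\<not> measure \<mu> (D 0) > 0"
      then have "measure \<mu> (D 0) = 0" by (simp add: zero_less_measure_iff)
      from AE_not_0[OF this D_sets] on_Omega have "AE \<omega> in \<mu>. \<not> W n (lift \<omega>)"
        by eventually_elim (simp add: D_def W_def)
      then show False using pos by blast
    qed
    have D_eq: "measure \<mu> (D x) = measure \<mu> (D 0)" for x
    proof -
      obtain i j where x: "x = (i, j)" by (cases x)
      have W: "W n (shift x s) \<longleftrightarrow> (\<exists>a. trifurcation n x (sites s a))" for s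
        unfolding W_def sites_shift trifurcation_translate by simp
      have "shift (2 * i, 2 * j) -` D 0 = D x"
      proof (intro set_eqI)
        fix \<omega>
        have O: "shift (2 * i, 2 * j) \<omega> \<in> Omega \<longleftrightarrow> \<omega> \<in> Omega" by (rule Omega_shift) simp
        show "\<omega> \<in> shift (2 * i, 2 * j) -` D 0 \<longleftrightarrow> \<omega> \<in> D x"
        proof (cases "\<omega> \<in> Omega")
          case True
          have "W n (lift (shift (2 * i, 2 * j) \<omega>)) = W n (shift x (lift \<omega>))"
            using lift_shift[OF True, of i j] fW unfolding x by metis
          then show ?thesis using True O W by (simp add: D_def W_def)
        qed (simp add: D_def O)
      qed
      moreover have "measure \<mu> (shift (2 * i, 2 * j) -` D 0) = measure (distr \<mu> \<mu> (shift (2 * i, 2 * j))) (D 0)"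
        using measure_distr[OF shift_measurable D_sets] by simp
      moreover have "distr \<mu> \<mu> (shift (2 * i, 2 * j)) = \<mu>" by (rule A1) simp
      ultimately show ?thesis by simp
    qed
    define p where "p = measure \<mu> (D 0)"
    have bound: "real (2 * k + 1) * p \<le> 24 * (real_of_int n + 1)" for k :: nat
    proof -
      define G where "G = {- int k..int k} \<times> {- int k..int k}"
      \<comment> \<open>Spacing \<open>2 * n + 1\<close> keeps boxes of radius \<open>n\<close>
        disjoint, and \<open>m\<close> below exceeds by one the largest norm they reach.\<close>
      define f where "f = (\<lambda>(i, j). ((2 * n + 1) * i, (2 * n + 1) * j))"
      define T where "T = f ` G"
      define m where "m = (2 * n + 1) * int k + n + 1"
      have inj: "inj_on f G" using n by (auto simp: inj_on_def f_def)
      have cT: "card T = (2 * k + 1)\<^sup>2"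
      proof -
        have "card {- int k..int k} = 2 * k + 1" by simp
        then have "card G = (2 * k + 1)\<^sup>2" unfolding G_def card_cartesian_product power2_eq_square by simp
        then show ?thesis unfolding T_def card_image[OF inj] .
      qed
      have finT: "finite T" unfolding T_def G_def by simp
      have disj: "sqbox x n \<inter> sqbox y n = {}" if "x \<in> T" "y \<in> T" "x \<noteq> y" for x y
      proof -
        have far: "\<bar>(2 * n + 1) * i - (2 * n + 1) * i'\<bar> \<ge> 2 * n + 1" if "i \<noteq> i'" for i i'
        proof -
          have "(2 * n + 1) * 1 \<le> (2 * n + 1) * \<bar>i - i'\<bar>" using that n by (intro mult_left_mono) auto
          also have "\<dots> = \<bar>(2 * n + 1) * (i - i')\<bar>" using n by (simp add: abs_mult)
          finally show ?thesis by (simp add: right_diff_distrib)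
        qed
        obtain i j i' j' where xy: "x = ((2*n+1)*i, (2*n+1)*j)" "y = ((2*n+1)*i', (2*n+1)*j')"
          using \<open>x \<in> T\<close> \<open>y \<in> T\<close> unfolding T_def f_def by auto
        then have "i \<noteq> i' \<or> j \<noteq> j'" using \<open>x \<noteq> y\<close> by auto
        then have "\<bar>fst x - fst y\<bar> \<ge> 2 * n + 1 \<or> \<bar>snd x - snd y\<bar> \<ge> 2 * n + 1"
          using far[of i i'] far[of j j'] by (auto simp: xy)
        then show ?thesis unfolding sqbox_def by auto
      qed
      have inside: "sqbox x n \<subseteq> {v. mx v < m}" if "x \<in> T" for x
      proof -
        obtain i j where ij: "x = ((2*n+1)*i, (2*n+1)*j)" "\<bar>i\<bar> \<le> int k" "\<bar>j\<bar> \<le> int k"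
        proof -
          obtain y where "y \<in> G" "x = f y" using \<open>x \<in> T\<close> unfolding T_def by blast
          then show thesis using that[of "fst y" "snd y"] unfolding G_def f_def by (cases y) auto
        qed
        have "\<bar>(2*n+1)*i\<bar> \<le> (2*n+1) * int k" "\<bar>(2*n+1)*j\<bar> \<le> (2*n+1) * int k"
          using ij n by (simp_all add: abs_mult mult_left_mono)
        then show ?thesis by (auto simp: sqbox_def mx_def m_def ij(1))
      qed
      have m0: "m \<ge> 0" unfolding m_def using n by simp
      have count: "(\<Sum>x\<in>T. indicat_real (D x) \<omega>) \<le> 2 * real_of_int (8 * m + 4)" for \<omega>
      proof -
        have "{x \<in> T. \<omega> \<in> D x} \<subseteq> {x \<in> T. trifurcation n x (sites (lift \<omega>) True)} \<union>
            {x \<in> T. trifurcation n x (sites (lift \<omega>) False)}"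
          unfolding D_def by (auto; metis (full_types))
        then have "card {x \<in> T. \<omega> \<in> D x} \<le> card ({x \<in> T. trifurcation n x (sites (lift \<omega>) True)} \<union>
            {x \<in> T. trifurcation n x (sites (lift \<omega>) False)})"
          by (rule card_mono[rotated]) (use finT in auto)
        also have "\<dots> \<le> card {x \<in> T. trifurcation n x (sites (lift \<omega>) True)} +
            card {x \<in> T. trifurcation n x (sites (lift \<omega>) False)}" by (rule card_Un_le)
        also have "\<dots> \<le> nat (8 * m + 4) + nat (8 * m + 4)"
          by (intro add_mono trifurcation_box_count finT disj inside m0)
        finally have "real (card {x \<in> T. \<omega> \<in> D x}) \<le> 2 * real_of_int (8 * m + 4)" using m0 by simp
        moreover have "(\<Sum>x\<in>T. indicat_real (D x) \<omega>) = real (card {x \<in> T. \<omega> \<in> D x})"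
          using sum.inter_filter[OF finT, of "\<lambda>_. 1 :: real" "\<lambda>x. \<omega> \<in> D x"] by (simp add: indicator_def of_bool_def)
        ultimately show ?thesis by simp
      qed
      have int: "integrable \<mu> (indicat_real (D x))" for x
        using D_sets by (intro integrable_real_indicator) (simp_all add: less_top[symmetric])
      have "(\<Sum>x\<in>T. measure \<mu> (D x)) = (\<Sum>x\<in>T. p)"
        unfolding p_def by (rule sum.cong[OF refl D_eq])
      then have "real ((2 * k + 1)\<^sup>2) * p = (\<Sum>x\<in>T. measure \<mu> (D x))"
        by (simp add: cT)
      also have "\<dots> = (\<Sum>x\<in>T. \<integral>\<omega>. indicat_real (D x) \<omega> \<partial>\<mu>)"
        by simp
      also have "\<dots> = (\<integral>\<omega>. (\<Sum>x\<in>T. indicat_real (D x) \<omega>) \<partial>\<mu>)"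
        by (rule Bochner_Integration.integral_sum[symmetric]) (rule int)
      also have "\<dots> \<le> 2 * real_of_int (8 * m + 4)"
      proof (rule integral_le_const)
        show "integrable \<mu> (\<lambda>\<omega>. \<Sum>x\<in>T. indicat_real (D x) \<omega>)"
          by (rule Bochner_Integration.integrable_sum) (rule int)
        show "AE \<omega> in \<mu>. (\<Sum>x\<in>T. indicat_real (D x) \<omega>) \<le> 2 * real_of_int (8 * m + 4)"
          by (rule AE_I2) (rule count)
      qed
      also have "\<dots> \<le> 24 * (real_of_int n + 1) * real (2 * k + 1)"
      proof -
        \<comment> \<open>The left side expands to
          \<open>(32 * n + 16) * int k + 16 * n + 24\<close>, which the right side dominates term by
          term.\<close>
        have "2 * (8 * m + 4) \<le> 24 * (n + 1) * (2 * int k + 1)"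
        proof -
          have "0 \<le> n * int k" using n by simp
          then show ?thesis unfolding m_def using n by (simp add: algebra_simps)
        qed
        then have "real_of_int (2 * (8 * m + 4)) \<le> real_of_int (24 * (n + 1) * (2 * int k + 1))"
          by (simp only: of_int_le_iff)
        then show ?thesis by (simp add: add.commute)
      qed
      finally have "real (2 * k + 1) * (real (2 * k + 1) * p) \<le> real (2 * k + 1) * (24 * (real_of_int n + 1))"
        by (simp add: power2_eq_square algebra_simps)
      then show ?thesis by (rule mult_left_le_imp_le) simp
    qed
    obtain k :: nat where "24 * (real_of_int n + 1) / p < real k" using reals_Archimedean2 by blast
    then have "24 * (real_of_int n + 1) < real k * p" using D0 by (simp add: p_def field_simps)
    also have "\<dots> \<le> real (2 * k + 1) * p" using D0 by (intro mult_right_mono) (auto simp: p_def)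
    finally show False using bound[of k] by linarith
  qed
  have "AE \<omega> in \<mu>. \<not> Q (lift \<omega>)"
  proof (rule finite_energy[where Q = Q and W = "\<lambda>s. \<exists>n. W n s"])
    show "Measurable.pred cfg_space (\<lambda>s. \<exists>n. W n s)" using mW by simp
    show "AE \<omega> in \<mu>. \<not> (\<exists>n. W n (lift \<omega>))" using null by (simp add: AE_all_countable)
    show "\<exists>F. finite F \<and> (\<exists>n. W n (flip_on F s))" if "Q s" for s
    proof -
      obtain a where "three_inf (sites s a)" using \<open>Q s\<close> unfolding Q_def by blast
      then obtain n where n: "trifurcation n 0 (sites s a \<union> sqbox 0 n)" using trifurcation_exists by blast
      let ?F = "{x \<in> sqbox 0 n. s x \<noteq> a}"
      have "sites (flip_on ?F s) a = sites s a \<union> sqbox 0 n" by (auto simp: sites_def flip_on_def)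
      with n have "W n (flip_on ?F s)" unfolding W_def by metis
      moreover have "finite ?F" using finite_subset[OF _ finite_box[of 0 n], of ?F] by blast
      ultimately show ?thesis by blast
    qed
  qed (simp_all add: mQ fQ fW)
  then show ?thesis by eventually_elim (simp add: Q_def)
qed


lemma sites_pred: "Measurable.pred cfg_space (\<lambda>s. v \<in> sites s a)"
  by (rule pred_sites[where s = "\<lambda>s. s", OF pred_coordinate])

lemma two_inf_pred [measurable]: "Measurable.pred cfg_space (\<lambda>s. two_inf (sites s a))"
  by (rule pred_two_inf[where X = "\<lambda>s. sites s a"]) (rule sites_pred)

lemma three_inf_pred [measurable]: "Measurable.pred cfg_space (\<lambda>s. three_inf (sites s a))"
  by (rule pred_three_inf[where X = "\<lambda>s. sites s a"]) (rule sites_pred)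

lemma has_inf_pred [measurable]: "Measurable.pred cfg_space (\<lambda>s. inf_sites (sites s a) \<noteq> {})"
proof -
  have [measurable]: "Measurable.pred cfg_space (\<lambda>s. v \<in> inf_sites (sites s a))" for v
    by (rule pred_inf_sites[where X = "\<lambda>s. sites s a"]) (rule sites_pred)
  show ?thesis unfolding ex_in_conv[symmetric] by simp
qed

lemma inf_empty_translate: "inf_sites ((\<lambda>x. x + t) -` X) = {} \<longleftrightarrow> inf_sites X = {}"
  unfolding inf_sites_translate
  unfolding vimage_translate by simp

text \<open>By asymmetry, both signs or neither have two infinite clusters. The former would hold
  almost surely if it were not null, yet merging inside a box would destroy it with positive
  probability.\<close>

lemma no_two_infinite: "AE \<omega> in \<mu>. \<forall>a. \<not> two_inf (sites (lift \<omega>) a)"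
proof -
  have asym: "AE \<omega> in \<mu>. \<not> (two_inf (sites (lift \<omega>) True) \<and> \<not> two_inf (sites (lift \<omega>) False)) \<and>
      \<not> (two_inf (sites (flip (lift \<omega>)) True) \<and> \<not> two_inf (sites (flip (lift \<omega>)) False))"
    by (rule asymmetric_null[where Q = "\<lambda>s. two_inf (sites s True) \<and> \<not> two_inf (sites s False)"])
      (auto simp: sites_shift sites_flip two_inf_translate)
  define Q where "Q s \<longleftrightarrow> (\<forall>a. two_inf (sites s a) \<and> \<not> three_inf (sites s a))" for s
  have mQ: "Measurable.pred cfg_space Q" unfolding Q_def[abs_def] by simp
  have inv: "invariant Q"
    unfolding invariant_def Q_def sites_shift sites_flip two_inf_translate three_inf_translate
    by (auto simp: all_bool_eq)
  have "AE \<omega> in \<mu>. \<not> Q (lift \<omega>)"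
  proof (rule ccontr)
    assume *: "\<not> ?thesis"
    then have "AE \<omega> in \<mu>. Q (lift \<omega>)" using zero_one[OF mQ inv] by blast
    then have null: "AE \<omega> in \<mu>. \<not> \<not> Q (lift \<omega>)" by simp
    have "AE \<omega> in \<mu>. \<not> Q (lift \<omega>)"
    proof (rule finite_energy[where W = "\<lambda>s. \<not> Q s", OF mQ _ _ _ _ null])
      show "Measurable.pred cfg_space (\<lambda>s. \<not> Q s)" using mQ by simp
      show "Q (flip s) = Q s" "(\<not> Q (flip s)) = (\<not> Q s)" for s using inv by (simp_all add: invariant_def)
      show "\<exists>F. finite F \<and> \<not> Q (flip_on F s)" if "Q s" for s
      proof -
        have "two_inf (sites s True)" "\<not> three_inf (sites s True)" using \<open>Q s\<close> unfolding Q_def by auto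
        from merge[OF this] obtain n where n: "\<not> two_inf (sites s True \<union> sqbox 0 n)" by blast
        let ?F = "{x \<in> sqbox 0 n. s x \<noteq> True}"
        have "sites (flip_on ?F s) True = sites s True \<union> sqbox 0 n" by (auto simp: sites_def flip_on_def)
        \<comment> \<open>Filling the box may alter the clusters of the other sign in any way; one
          sign without two infinite clusters already refutes \<open>Q\<close>.\<close>
        with n have "\<not> Q (flip_on ?F s)" unfolding Q_def by metis
        moreover have "finite ?F" using finite_subset[OF _ finite_box[of 0 n], of ?F] by blast
        ultimately show ?thesis by blast
      qed
    qed
    with * show False by blast
  qed
  with asym no_three_infinite show ?thesis
    by eventually_elim (auto simp: Q_def sites_flip all_bool_eq)
qed

section \<open>Excluding one infinite cluster of each sign\<close>

definition constant_sign :: "config \<Rightarrow> config \<Rightarrow> bool \<Rightarrow> bool" where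
  "constant_sign s t b \<longleftrightarrow> (\<forall>a. face_sign s t a b \<and> \<not> face_sign s t a (\<not> b))"

text \<open>Negating \<open>s\<close> merely exchanges the two interfaces, so a value common to both
  does not depend on the sign of \<open>s\<close>.\<close>

lemma constant_sign_flip1: "constant_sign (flip s) t b = constant_sign s t b"
  unfolding constant_sign_def face_sign_flip1 by (auto simp: all_bool_eq)

lemma constant_sign_flip2: "constant_sign s (flip t) b = constant_sign s t (\<not> b)"
  unfolding constant_sign_def face_sign_flip2 by simp

lemma constant_sign_shift: "constant_sign (shift x s) (shift x t) b = constant_sign s t b"
  unfolding constant_sign_def face_sign_shift by simp

lemma constant_sign_unique: "constant_sign s t b \<Longrightarrow> constant_sign s t c \<Longrightarrow> c = b"
  unfolding constant_sign_def by (cases b; cases c) simp_all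

lemma pred_constant_sign:
  assumes "\<And>v. Measurable.pred M (\<lambda>w. s w v)" "\<And>v. Measurable.pred M (\<lambda>w. t w v)"
  shows "Measurable.pred M (\<lambda>w. constant_sign (s w) (t w) b)"
proof -
  have [measurable]: "Measurable.pred M (\<lambda>w. face_sign (s w) (t w) a b)" for a b
    by (rule pred_face_sign[where s = s and t = t]) (rule assms)+
  show ?thesis unfolding constant_sign_def by simp
qed

definition one_each :: "config \<Rightarrow> bool" where
  "one_each s \<longleftrightarrow> (\<forall>a. inf_sites (sites s a) \<noteq> {} \<and> \<not> two_inf (sites s a))"

text \<open>Each \<open>a\<close> has exactly one value. If the two values differed, they would be
  \<open>a\<close> for both or \<open>\<not> a\<close> for both; negating one field exchanges these
  cases, and \<open>odd_null\<close> excludes both.\<close>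

lemma constant_sign_ex:
  assumes "AE \<omega> in \<mu>. one_each (lift \<omega>)"
  shows "AE \<omega> in \<mu>. \<exists>b. constant_sign (lift \<omega>) (dual_lift \<omega>) b"
proof -
  let ?R = "\<lambda>s t. \<forall>a. face_sign s t a (\<not> a) \<and> \<not> face_sign s t a a"
  have "AE \<omega> in \<mu>. \<not> ?R (lift \<omega>) (dual_lift \<omega>) \<and> \<not> ?R (flip (lift \<omega>)) (dual_lift \<omega>)"
  proof (rule odd_null[where R = ?R])
    fix s t :: "config \<Rightarrow> config"
    assume s: "\<And>v. Measurable.pred \<mu> (\<lambda>\<omega>. s \<omega> v)" and t: "\<And>v. Measurable.pred \<mu> (\<lambda>\<omega>. t \<omega> v)"
    have [measurable]: "Measurable.pred \<mu> (\<lambda>w. face_sign (s w) (t w) a b)" for a b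
      by (rule pred_face_sign[where s = s and t = t]) (rule s t)+
    show "Measurable.pred \<mu> (\<lambda>\<omega>. ?R (s \<omega>) (t \<omega>))" by simp
  qed (auto simp: face_sign_shift face_sign_flip1 face_sign_flip2 all_bool_eq)
  with assms on_Omega show ?thesis
  proof eventually_elim
    case (elim \<omega>)
    have ex1: "\<exists>!b. face_sign (lift \<omega>) (dual_lift \<omega>) a b" for a
      by (rule face_sign_ex1[OF noncrossing_lift[OF elim(2)]]) (use elim(1) in \<open>auto simp: one_each_def\<close>)
    then have "\<forall>a. face_sign (lift \<omega>) (dual_lift \<omega>) a True \<noteq> face_sign (lift \<omega>) (dual_lift \<omega>) a False"
      by (metis (full_types))
    with elim(3) show ?case
      unfolding constant_sign_def face_sign_flip1 by (auto simp: all_bool_eq ex_bool_eq)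
  qed
qed

lemma not_one_each: "\<not> (AE \<omega> in \<mu>. one_each (lift \<omega>))"
proof
  assume one: "AE \<omega> in \<mu>. one_each (lift \<omega>)"
  \<comment> \<open>The value \<open>b\<close> follows the sign of \<open>t\<close>, and the value
    with the roles exchanged follows the sign of \<open>s\<close>. Joint negation preserves their
    disagreement; negating one field turns it into agreement.\<close>
  let ?R = "\<lambda>s t. \<exists>b. constant_sign s t b \<and> constant_sign t (shift (1, 1) s) (\<not> b)"
  have null: "AE \<omega> in \<mu>. \<not> ?R (lift \<omega>) (dual_lift \<omega>) \<and> \<not> ?R (flip (lift \<omega>)) (dual_lift \<omega>)"
  proof (rule odd_null[where R = ?R])
    fix s t :: "config \<Rightarrow> config"
    assume s: "\<And>v. Measurable.pred \<mu> (\<lambda>\<omega>. s \<omega> v)" and t: "\<And>v. Measurable.pred \<mu> (\<lambda>\<omega>. t \<omega> v)"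
    have [measurable]: "Measurable.pred \<mu> (\<lambda>w. constant_sign (s w) (t w) b)"
      "Measurable.pred \<mu> (\<lambda>w. constant_sign (t w) (shift (1, 1) (s w)) b)" for b
      by (rule pred_constant_sign[where s = s and t = t], rule s, rule t)
        (rule pred_constant_sign[where s = t and t = "\<lambda>w. shift (1, 1) (s w)"], rule t, simp add: shift_apply s)
    show "Measurable.pred \<mu> (\<lambda>\<omega>. ?R (s \<omega>) (t \<omega>))" by simp
  next
    fix x s t
    have "shift (1, 1) (shift x s) = shift x (shift (1, 1) s)" by (simp add: shift_shift add.commute)
    then show "?R (shift x s) (shift x t) = ?R s t" by (simp add: constant_sign_shift)
  next
    fix s t show "?R (flip s) (flip t) = ?R s t"
      by (simp add: shift_flip constant_sign_flip1 constant_sign_flip2 ex_bool_eq disj_commute)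
  next
    fix s t assume "?R s t"
    then obtain b where b: "constant_sign s t b" "constant_sign t (shift (1, 1) s) (\<not> b)" by blast
    show "\<not> ?R (flip s) t"
    proof
      assume "?R (flip s) t"
      then obtain c where "constant_sign s t c" "constant_sign t (shift (1, 1) s) c"
        by (auto simp: shift_flip constant_sign_flip1 constant_sign_flip2)
      then show False using constant_sign_unique[OF b(1)] constant_sign_unique[OF b(2)] by blast
    qed
  qed
  note const = constant_sign_ex[OF one]
  have m: "Measurable.pred \<mu> (\<lambda>\<omega>. \<exists>b. constant_sign (lift \<omega>) (dual_lift \<omega>) b)"
  proof -
    have [measurable]: "Measurable.pred \<mu> (\<lambda>\<omega>. constant_sign (lift \<omega>) (dual_lift \<omega>) b)" for b
      by (rule pred_constant_sign[where s = lift and t = dual_lift]) simp_all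
    show ?thesis by simp
  qed
  have const': "AE \<omega> in \<mu>. \<exists>b. constant_sign (lift (shift (1, 1) \<omega>)) (dual_lift (shift (1, 1) \<omega>)) b"
    using const AE_shift[OF _ m, of 1 1] by simp
  have "AE \<omega> in \<mu>. False"
    using null const const' on_Omega
  proof eventually_elim
    case (elim \<omega>)
    obtain b where b: "constant_sign (lift \<omega>) (dual_lift \<omega>) b" using elim(2) by blast
    obtain c where c: "constant_sign (dual_lift \<omega>) (dual_lift (shift (1, 1) \<omega>)) c"
      using elim(3) unfolding dual_lift_def by blast
    \<comment> \<open>Exchanging the lattices twice is the translation (2,2), one step of faces, so
      up to sign the third field is a translate of the first.\<close>
    have "dual_lift (shift (1, 1) \<omega>) = lift (shift (2 * 1, 2 * 1) \<omega>)" by (simp add: dual_lift_def shift_shift)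
    then have "dual_lift (shift (1, 1) \<omega>) = shift (1, 1) (lift \<omega>) \<or> dual_lift (shift (1, 1) \<omega>) = flip (shift (1, 1) (lift \<omega>))"
      using lift_shift[OF elim(4), of 1 1] by simp
    then obtain d where d: "constant_sign (dual_lift \<omega>) (shift (1, 1) (lift \<omega>)) d"
      using c by (auto simp: constant_sign_flip2)
    show ?case
    proof (cases "d = b")
      case True
      then have "?R (flip (lift \<omega>)) (dual_lift \<omega>)"
        using b d by (auto simp: shift_flip constant_sign_flip1 constant_sign_flip2)
      then show ?thesis using elim(1) by blast
    next
      case False
      then have "?R (lift \<omega>) (dual_lift \<omega>)" using b d by auto
      then show ?thesis using elim(1) by blast
    qed
  qed
  then show False by simp
qed

text \<open>Infinite clusters occur for both signs or for neither. By the zero-one law and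
  uniqueness, the former would be the excluded coexistence.\<close>

lemma no_infinite_component: "AE \<omega> in \<mu>. \<forall>v. finite (component \<omega> v)"
proof -
  let ?I = "\<lambda>s a. inf_sites (sites s a) \<noteq> {}"
  have asym: "AE \<omega> in \<mu>. \<not> (?I (lift \<omega>) True \<and> \<not> ?I (lift \<omega>) False) \<and>
      \<not> (?I (flip (lift \<omega>)) True \<and> \<not> ?I (flip (lift \<omega>)) False)"
  proof (rule asymmetric_null[where Q = "\<lambda>s. ?I s True \<and> \<not> ?I s False"])
    show "Measurable.pred cfg_space (\<lambda>s. ?I s True \<and> \<not> ?I s False)"
      by (intro pred_intros_logic has_inf_pred)
  qed (auto simp: sites_shift sites_flip inf_empty_translate)
  define Q where "Q s \<longleftrightarrow> (\<forall>a. ?I s a)" for s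
  have mQ: "Measurable.pred cfg_space Q"
    unfolding Q_def[abs_def] by (intro pred_intros_countable has_inf_pred)
  have inv: "invariant Q"
    unfolding invariant_def Q_def sites_shift sites_flip inf_empty_translate by (auto simp: all_bool_eq)
  have "\<not> (AE \<omega> in \<mu>. Q (lift \<omega>))"
  proof
    assume "AE \<omega> in \<mu>. Q (lift \<omega>)"
    with no_two_infinite have "AE \<omega> in \<mu>. one_each (lift \<omega>)"
      by eventually_elim (simp add: Q_def one_each_def)
    then show False using not_one_each by blast
  qed
  then have "AE \<omega> in \<mu>. \<not> Q (lift \<omega>)" using zero_one[OF mQ inv] by blast
  with asym on_Omega show ?thesis
  proof eventually_elim
    case (elim \<omega>)
    then have "inf_sites (sites (lift \<omega>) a) = {}" for a
      by (cases a) (auto simp: Q_def sites_flip all_bool_eq)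
    then show ?case using finite_component[OF elim(2)] by blast
  qed
qed

end

theorem theorem1p3:
  fixes \<mu> :: "config measure"
  assumes prob: "prob_space \<mu>"
    and sets_mu: "sets \<mu> = sets cfg_space"
    and on_Omega: "AE \<omega> in \<mu>. \<omega> \<in> Omega"
    and A1: "\<And>a b. even (a + b) \<Longrightarrow> distr \<mu> \<mu> (shift (a, b)) = \<mu>"
    and A2: "\<And>E. E \<in> sets \<mu> \<Longrightarrow> (\<forall>a b. shift (2*a, 2*b) -` E = E) \<Longrightarrow>
               measure \<mu> E = 0 \<or> measure \<mu> E = 1"
    and A3: "distr \<mu> \<mu> flip = \<mu>"
    and A4: "\<And>S E. S \<in> L1_faces \<Longrightarrow> E \<in> sets L1_cfg_space \<Longrightarrow>
               measure (distr \<mu> L1_cfg_space phi1_cfg) E > 0 \<Longrightarrow>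
               measure (distr \<mu> L1_cfg_space phi1_cfg) (flip_face S ` E) > 0"
  shows "AE \<omega> in \<mu>. \<forall>v. finite (component \<omega> v)"
proof -
  interpret constrained_percolation \<mu>
    using prob sets_mu on_Omega A1 A2 A3 A4
    by (intro constrained_percolation.intro constrained_percolation_axioms.intro)
  show ?thesis by (rule no_infinite_component)
qed

end
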